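(* Let $\mathcal B=\mathbb R^{3N}(u_1,v_1,w_1,\dots,u_N,v_N,w_N)$ and $$U=\sum_{k=1}^N u_kE_{kk}+\lambda\sum_{k=1}^N E_{k+1,k},\quad V=I+\lambda^{-1}\sum_{k=1}^N v_kE_{k,k+1},\quad W=I+\lambda^{-1}\sum_{k=1}^N w_kE_{k,k+1},\quad \mathcal F=I-h\lambda\sum_{k=1}^NE_{k+1,k}.$$ The hierarchy associated with the Lax matrix $L_+=\mathcal F^{-1}UWV$ is described by the Lax triads $$\dot U=\mathcal A_1U-U\mathcal A_3,\qquad \dot V=\mathcal A_2V-V\mathcal A_0,\qquad \dot W=\mathcal A_3W-W\mathcal A_2,$$ supplemented by the identity $$\dot{\mathcal F}=0=\mathcal A_1\mathcal F-\mathcal F\mathcal A_0,$$ so that $L_+$ satisfies the Lax equation $\dot L_+=[\mathcal A_0,L_+]$. Here $$\mathcal A_0=\pi_-(f(L_+))-\sigma(f(L_+)),$$ and the matrices $\mathcal A_1,\mathcal A_2,\mathcal A_3$ are uniquely defined by the condition of compatibility of these equations. In particular, for the "first" flow of the hierarchy, corresponding to $f(L)=L$, one has $$\mathcal A_0=\lambda^{-1}\sum_{k=1}^N(w_{k-1}v_k+u_kv_k+u_kw_k+hu_{k-1}w_{k-1}v_k)E_{k,k+1}+\lambda^{-2}\sum_{k=1}^Nu_kw_kv_{k+1}E_{k,k+2}-h\sum_{k=1}^N\gamma_kE_{kk},$$ $$\mathcal A_1=\lambda^{-1}\sum_{k=1}^N(w_{k-1}v_k+u_kv_k+u_kw_k+hu_kw_kv_{k+1})E_{k,k+1}+\lambda^{-2}\sum_{k=1}^Nu_kw_kv_{k+1}E_{k,k+2}-h\sum_{k=1}^N\gamma_{k-1}E_{kk},$$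 $$\mathcal A_2=\lambda^{-1}\sum_{k=1}^N(u_kw_k+v_kw_k+v_ku_{k+1}+hu_kv_kw_k)E_{k,k+1}+\lambda^{-2}\sum_{k=1}^Nv_ku_{k+1}w_{k+1}E_{k,k+2}-h\sum_{k=1}^N\gamma_kE_{kk},$$ $$\mathcal A_3=\lambda^{-1}\sum_{k=1}^N(v_ku_{k+1}+w_ku_{k+1}+w_kv_{k+1}+hw_ku_{k+1}v_{k+1})E_{k,k+1}+\lambda^{-2}\sum_{k=1}^Nw_kv_{k+1}u_{k+2}E_{k,k+2}-h\sum_{k=1}^N\gamma_kE_{kk},$$ where $$\gamma_k=w_{k-1}v_k+u_kv_k+u_kw_k+hu_{k-1}w_{k-1}v_k+hu_kw_kv_{k+1}.$$ The equations of motion of the "first" flow read $$\dot u_k=u_k(v_k+w_k-v_{k-1}-w_{k-1}+hw_kv_{k+1}-hw_{k-1}v_k+h\gamma_k-h\gamma_{k-1}),$$ $$\dot v_k=v_k(w_k+u_{k+1}-w_{k-1}-u_k+hu_kw_k-hu_{k-1}w_{k-1}+h\gamma_{k+1}-h\gamma_k),$$ $$\dot w_k=w_k(u_{k+1}+v_{k+1}-u_k-v_k+hu_{k+1}v_{k+1}-hu_kv_k+h\gamma_{k+1}-h\gamma_k).$$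
   Context: All subscripts are taken mod $N$ (periodic boundary conditions); $h$ is a (small) real parameter. $E_{jk}$ is the $N\times N$ matrix unit (indices mod $N$). With $\mathcal E=\lambda\sum_kE_{k+1,k}$ and $\mathcal E^{-1}=\lambda^{-1}\sum_kE_{k,k+1}$, $\mathfrak g$ is the twisted loop algebra of elements $\sum_p\ell^{(p)}\mathcal E^p$ with $\ell^{(p)}$ diagonal $\lambda$-independent $N\times N$ matrices (Laurent polynomials in $\lambda$; $\mathcal F^{-1}=\sum_{n\ge0}h^n\mathcal E^n$ is understood as a series in positive powers of $\lambda$). $\pi_-(\sum_p\ell^{(p)}\mathcal E^p)=\sum_{p<0}\ell^{(p)}\mathcal E^p$, and $\sigma$ is the linear map into diagonal matrices $\sigma(\sum_p\ell^{(p)}\mathcal E^p)=\sum_{p<0}h^{-p}\ell^{(p)}$. $f$ is a conjugation covariant function on $\mathfrak g$ (e.g. a polynomial), one flow of the hierarchy for each $f$. "Compatibility" means that the matrix equations consistently define an evolution of the coordinates $(u,v,w)$: $\mathcal A_1\mathcal F=\mathcal F\mathcal A_0$, the expression $\mathcal A_1U-U\mathcal A_3$ is a $\lambda$-independent diagonal matrix (which is then $\dot U={\rm diag}(\dot u_k)$), and $\mathcal A_2V-V\mathcal A_0$ and $\mathcal A_3W-W\mathcal A_2$ are of the form $\lambda^{-1}\sum_kc_kE_{k,k+1}$ (giving $\dot v_k$, resp. $\dot w_k$, as the coefficients $c_k$).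
   Formalization: Pointwise uniqueness of A_1, A_2, A_3 fails at some points (e.g. u=v=w=0); it is proved where at least two of the families (u_k), (v_k), (w_k) have no zero entry, and on all of R^{3N} for matrices depending continuously on (u,v,w). *)

theory Defs
  imports
    "HOL-Analysis.Function_Topology"
    "HOL-Computational_Algebra.Formal_Laurent_Series"
    "Jordan_Normal_Form.Matrix"
begin

(* The phase space R^{3N} with periodic boundary conditions: a family (u_k) with k taken
   mod N is an N-periodic function on int, so that u (k - 1), u (k + 1) need no reduction.
   The topology used on it is the product topology, i.e. that of R^{3N}. *)

type_synonym phase_pt = "(int \<Rightarrow> real) \<times> (int \<Rightarrow> real) \<times> (int \<Rightarrow> real)"

definition periodic :: "nat \<Rightarrow> (int \<Rightarrow> real) \<Rightarrow> bool" where
  "periodic N a \<longleftrightarrow> (\<forall>k. a (k + int N) = a k)"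

definition phase :: "nat \<Rightarrow> phase_pt set" where
  "phase N = {(u, v, w). periodic N u \<and> periodic N v \<and> periodic N w}"

(* Matrices are N x N over formal Laurent series in \<lambda>: finitely many negative powers,
   possibly infinitely many positive ones. Rows and columns are numbered 0..N-1, and the
   index k of the mathematics sits at position k mod N (so k = N is position 0). *)

definition ix :: "nat \<Rightarrow> int \<Rightarrow> nat" where
  "ix N k = nat (k mod int N)"

definition munit :: "nat \<Rightarrow> int \<Rightarrow> int \<Rightarrow> real fls mat" where
  "munit N j k = mat N N (\<lambda>(a, b). if a = ix N j \<and> b = ix N k then 1 else 0)"

(* lamsum N p c M = \<lambda>^p \<Sum>_{k=1}^N c_k M_k; the factor c_k \<lambda>^p is
   fls_shift (- p) (fls_const (c k)). *)
definition lamsum :: "nat \<Rightarrow> int \<Rightarrow> (int \<Rightarrow> real) \<Rightarrow> (int \<Rightarrow> real fls mat) \<Rightarrow> real fls mat" where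
  "lamsum N p c M =
     mat N N (\<lambda>ab. \<Sum>k = 1..int N. fls_shift (- p) (fls_const (c k)) * (M k $$ ab))"

(* loop N l = \<Sum>_p l^(p) \<E>^p with l^(p) = diag(l p k) and \<E> = \<lambda> \<Sum>_k E_{k+1,k}.
   As \<E>^p = \<lambda>^p \<Sum>_k E_{k+p,k} for every integer p, the entry of l^(p) \<E>^p at (a,b)
   is \<lambda>^p l_a^(p) if a - b = p mod N, and 0 otherwise. Meaningful when l p vanishes for
   all p below some bound, so that Abs_fls is applied to a genuine Laurent series. *)
definition loop :: "nat \<Rightarrow> (int \<Rightarrow> int \<Rightarrow> real) \<Rightarrow> real fls mat" where
  "loop N l = mat N N (\<lambda>(a, b).
     Abs_fls (\<lambda>p. if int N dvd p - (int a - int b) then l p (int a) else 0))"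

(* The twisted loop algebra: loop_poly consists of Laurent polynomials; loop_series is its
   completion by series in positive powers of \<lambda>, needed for \<F>^{-1} and hence L_+. *)
definition loop_series :: "nat \<Rightarrow> real fls mat set" where
  "loop_series N = {loop N l | l. \<exists>m. \<forall>p<m. \<forall>k. l p k = 0}"

definition loop_poly :: "nat \<Rightarrow> real fls mat set" where
  "loop_poly N = {loop N l | l. \<exists>m. \<forall>p. m < \<bar>p\<bar> \<longrightarrow> (\<forall>k. l p k = 0)}"

(* the k-th diagonal entry of l^(p), for X = \<Sum>_p l^(p) \<E>^p *)
definition dcoef :: "nat \<Rightarrow> real fls mat \<Rightarrow> int \<Rightarrow> int \<Rightarrow> real" where
  "dcoef N X p k = fls_nth (X $$ (ix N k, ix N (k - p))) p"

definition pi_minus :: "nat \<Rightarrow> real fls mat \<Rightarrow> real fls mat" where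
  "pi_minus N X = loop N (\<lambda>p k. if p < 0 then dcoef N X p k else 0)"

(* the index set of the inner sum is finite: Laurent series have finitely many negative powers *)
definition sigma :: "nat \<Rightarrow> real \<Rightarrow> real fls mat \<Rightarrow> real fls mat" where
  "sigma N h X = lamsum N 0
     (\<lambda>k. \<Sum>p | p < 0 \<and> dcoef N X p k \<noteq> 0. h ^ nat (- p) * dcoef N X p k)
     (\<lambda>k. munit N k k)"

definition Umat :: "nat \<Rightarrow> (int \<Rightarrow> real) \<Rightarrow> real fls mat" where
  "Umat N u = lamsum N 0 u (\<lambda>k. munit N k k) + lamsum N 1 (\<lambda>_. 1) (\<lambda>k. munit N (k + 1) k)"

definition Vmat :: "nat \<Rightarrow> (int \<Rightarrow> real) \<Rightarrow> real fls mat" where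
  "Vmat N v = 1\<^sub>m N + lamsum N (-1) v (\<lambda>k. munit N k (k + 1))"

definition Wmat :: "nat \<Rightarrow> (int \<Rightarrow> real) \<Rightarrow> real fls mat" where
  "Wmat N w = 1\<^sub>m N + lamsum N (-1) w (\<lambda>k. munit N k (k + 1))"

definition Fmat :: "nat \<Rightarrow> real \<Rightarrow> real fls mat" where
  "Fmat N h = 1\<^sub>m N - lamsum N 1 (\<lambda>_. h) (\<lambda>k. munit N (k + 1) k)"

(* \<F>^{-1} = \<Sum>_{n \<ge> 0} h^n \<E>^n *)
definition Finv :: "nat \<Rightarrow> real \<Rightarrow> real fls mat" where
  "Finv N h = loop N (\<lambda>p k. if 0 \<le> p then h ^ nat p else 0)"

definition Lplus ::
  "nat \<Rightarrow> real \<Rightarrow> (int \<Rightarrow> real) \<Rightarrow> (int \<Rightarrow> real) \<Rightarrow> (int \<Rightarrow> real) \<Rightarrow> real fls mat" where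
  "Lplus N h u v w = Finv N h * Umat N u * Wmat N w * Vmat N v"

definition conj_covariant :: "nat \<Rightarrow> (real fls mat \<Rightarrow> real fls mat) \<Rightarrow> bool" where
  "conj_covariant N f \<longleftrightarrow>
     (\<forall>X\<in>loop_series N. f X \<in> loop_series N) \<and>
     (\<forall>X\<in>loop_series N. \<forall>G\<in>loop_series N. \<forall>H\<in>loop_series N.
        G * H = 1\<^sub>m N \<longrightarrow> H * G = 1\<^sub>m N \<longrightarrow> f (G * X * H) = G * f X * H)"

definition A0mat ::
  "nat \<Rightarrow> real \<Rightarrow> (real fls mat \<Rightarrow> real fls mat) \<Rightarrow>
   (int \<Rightarrow> real) \<Rightarrow> (int \<Rightarrow> real) \<Rightarrow> (int \<Rightarrow> real) \<Rightarrow> real fls mat" where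
  "A0mat N h f u v w = pi_minus N (f (Lplus N h u v w)) - sigma N h (f (Lplus N h u v w))"

definition compatible ::
  "nat \<Rightarrow> real \<Rightarrow> (real fls mat \<Rightarrow> real fls mat) \<Rightarrow>
   (int \<Rightarrow> real) \<Rightarrow> (int \<Rightarrow> real) \<Rightarrow> (int \<Rightarrow> real) \<Rightarrow>
   real fls mat \<Rightarrow> real fls mat \<Rightarrow> real fls mat \<Rightarrow> bool" where
  "compatible N h f u v w A1 A2 A3 \<longleftrightarrow>
     A1 \<in> loop_poly N \<and> A2 \<in> loop_poly N \<and> A3 \<in> loop_poly N \<and>
     A1 * Fmat N h = Fmat N h * A0mat N h f u v w \<and>
     (\<exists>c. A1 * Umat N u - Umat N u * A3 = lamsum N 0 c (\<lambda>k. munit N k k)) \<and>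
     (\<exists>c. A2 * Vmat N v - Vmat N v * A0mat N h f u v w
            = lamsum N (-1) c (\<lambda>k. munit N k (k + 1))) \<and>
     (\<exists>c. A3 * Wmat N w - Wmat N w * A2 = lamsum N (-1) c (\<lambda>k. munit N k (k + 1)))"

(* Pointwise uniqueness of A1, A2, A3 holds where at least two of the three families
   have no zero; it fails e.g. at u = v = w = 0. *)
definition nondegenerate :: "(int \<Rightarrow> real) \<Rightarrow> (int \<Rightarrow> real) \<Rightarrow> (int \<Rightarrow> real) \<Rightarrow> bool" where
  "nondegenerate u v w \<longleftrightarrow>
     (\<forall>k. u k \<noteq> 0 \<and> v k \<noteq> 0) \<or> (\<forall>k. u k \<noteq> 0 \<and> w k \<noteq> 0) \<or> (\<forall>k. v k \<noteq> 0 \<and> w k \<noteq> 0)"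

(* A field of elements of the loop algebra over the phase space, with degree in \<lambda> bounded
   below, each of whose coefficients is continuous. *)
definition cont_field :: "nat \<Rightarrow> (phase_pt \<Rightarrow> real fls mat) \<Rightarrow> bool" where
  "cont_field N X \<longleftrightarrow>
     (\<forall>x\<in>phase N. X x \<in> loop_series N) \<and>
     (\<exists>m. \<forall>x\<in>phase N. \<forall>p<m. \<forall>k. dcoef N (X x) p k = 0) \<and>
     (\<forall>p k. continuous_on (phase N) (\<lambda>x. dcoef N (X x) p k))"

(* f X depends continuously on the phase point whenever X does; e.g. f polynomial *)
definition cont_preserving :: "nat \<Rightarrow> (real fls mat \<Rightarrow> real fls mat) \<Rightarrow> bool" where
  "cont_preserving N f \<longleftrightarrow> (\<forall>X. cont_field N X \<longrightarrow> cont_field N (\<lambda>x. f (X x)))"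

definition compatible_fields ::
  "nat \<Rightarrow> real \<Rightarrow> (real fls mat \<Rightarrow> real fls mat) \<Rightarrow>
   (phase_pt \<Rightarrow> real fls mat) \<Rightarrow> (phase_pt \<Rightarrow> real fls mat) \<Rightarrow> (phase_pt \<Rightarrow> real fls mat) \<Rightarrow> bool" where
  "compatible_fields N h f A1 A2 A3 \<longleftrightarrow>
     cont_field N A1 \<and> cont_field N A2 \<and> cont_field N A3 \<and>
     (\<forall>(u, v, w)\<in>phase N.
        compatible N h f u v w (A1 (u, v, w)) (A2 (u, v, w)) (A3 (u, v, w)))"

(* derivative of a matrix-valued curve, coefficient by coefficient in \<lambda> *)
definition has_mat_deriv :: "nat \<Rightarrow> (real \<Rightarrow> real fls mat) \<Rightarrow> real fls mat \<Rightarrow> real \<Rightarrow> bool" where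
  "has_mat_deriv N X D t \<longleftrightarrow>
     (\<forall>i<N. \<forall>j<N. \<forall>p.
        ((\<lambda>s. fls_nth (X s $$ (i, j)) p) has_real_derivative fls_nth (D $$ (i, j)) p) (at t))"

(* the Lax triad, with the supplementary identity, along a curve at time t *)
definition lax_triad ::
  "nat \<Rightarrow> real \<Rightarrow> real fls mat \<Rightarrow> real fls mat \<Rightarrow> real fls mat \<Rightarrow> real fls mat \<Rightarrow>
   (real \<Rightarrow> int \<Rightarrow> real) \<Rightarrow> (real \<Rightarrow> int \<Rightarrow> real) \<Rightarrow> (real \<Rightarrow> int \<Rightarrow> real) \<Rightarrow> real \<Rightarrow> bool" where
  "lax_triad N h A0 A1 A2 A3 u v w t \<longleftrightarrow>
     has_mat_deriv N (\<lambda>s. Umat N (u s)) (A1 * Umat N (u t) - Umat N (u t) * A3) t \<and>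
     has_mat_deriv N (\<lambda>s. Vmat N (v s)) (A2 * Vmat N (v t) - Vmat N (v t) * A0) t \<and>
     has_mat_deriv N (\<lambda>s. Wmat N (w s)) (A3 * Wmat N (w t) - Wmat N (w t) * A2) t \<and>
     has_mat_deriv N (\<lambda>s. Fmat N h) (A1 * Fmat N h - Fmat N h * A0) t \<and>
     A1 * Fmat N h - Fmat N h * A0 = 0\<^sub>m N N"

definition gam ::
  "real \<Rightarrow> (int \<Rightarrow> real) \<Rightarrow> (int \<Rightarrow> real) \<Rightarrow> (int \<Rightarrow> real) \<Rightarrow> int \<Rightarrow> real" where
  "gam h u v w k = w (k - 1) * v k + u k * v k + u k * w k
     + h * u (k - 1) * w (k - 1) * v k + h * u k * w k * v (k + 1)"

definition first_A0 ::
  "nat \<Rightarrow> real \<Rightarrow> (int \<Rightarrow> real) \<Rightarrow> (int \<Rightarrow> real) \<Rightarrow> (int \<Rightarrow> real) \<Rightarrow> real fls mat" where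
  "first_A0 N h u v w =
     lamsum N (-1) (\<lambda>k. w (k - 1) * v k + u k * v k + u k * w k + h * u (k - 1) * w (k - 1) * v k)
       (\<lambda>k. munit N k (k + 1))
   + lamsum N (-2) (\<lambda>k. u k * w k * v (k + 1)) (\<lambda>k. munit N k (k + 2))
   - lamsum N 0 (\<lambda>k. h * gam h u v w k) (\<lambda>k. munit N k k)"

definition first_A1 ::
  "nat \<Rightarrow> real \<Rightarrow> (int \<Rightarrow> real) \<Rightarrow> (int \<Rightarrow> real) \<Rightarrow> (int \<Rightarrow> real) \<Rightarrow> real fls mat" where
  "first_A1 N h u v w =
     lamsum N (-1) (\<lambda>k. w (k - 1) * v k + u k * v k + u k * w k + h * u k * w k * v (k + 1))
       (\<lambda>k. munit N k (k + 1))
   + lamsum N (-2) (\<lambda>k. u k * w k * v (k + 1)) (\<lambda>k. munit N k (k + 2))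
   - lamsum N 0 (\<lambda>k. h * gam h u v w (k - 1)) (\<lambda>k. munit N k k)"

definition first_A2 ::
  "nat \<Rightarrow> real \<Rightarrow> (int \<Rightarrow> real) \<Rightarrow> (int \<Rightarrow> real) \<Rightarrow> (int \<Rightarrow> real) \<Rightarrow> real fls mat" where
  "first_A2 N h u v w =
     lamsum N (-1) (\<lambda>k. u k * w k + v k * w k + v k * u (k + 1) + h * u k * v k * w k)
       (\<lambda>k. munit N k (k + 1))
   + lamsum N (-2) (\<lambda>k. v k * u (k + 1) * w (k + 1)) (\<lambda>k. munit N k (k + 2))
   - lamsum N 0 (\<lambda>k. h * gam h u v w k) (\<lambda>k. munit N k k)"

definition first_A3 ::
  "nat \<Rightarrow> real \<Rightarrow> (int \<Rightarrow> real) \<Rightarrow> (int \<Rightarrow> real) \<Rightarrow> (int \<Rightarrow> real) \<Rightarrow> real fls mat" where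
  "first_A3 N h u v w =
     lamsum N (-1) (\<lambda>k. v k * u (k + 1) + w k * u (k + 1) + w k * v (k + 1)
         + h * w k * u (k + 1) * v (k + 1))
       (\<lambda>k. munit N k (k + 1))
   + lamsum N (-2) (\<lambda>k. w k * v (k + 1) * u (k + 2)) (\<lambda>k. munit N k (k + 2))
   - lamsum N 0 (\<lambda>k. h * gam h u v w k) (\<lambda>k. munit N k k)"

lemma ix_eq_iff: "0 < N \<Longrightarrow> ix N j = ix N k \<longleftrightarrow> int N dvd j - k"
  by (simp add: ix_def nat_eq_iff mod_eq_dvd_iff)

lemma ix_of_nat: "a < N \<Longrightarrow> ix N (int a) = a"
  by (simp add: ix_def)

lemma Fmat_index:
  assumes a: "a < N" and b: "b < N"
  shows "Fmat N h $$ (a, b) =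
    (if a = b then 1 else 0)
    - (if b = ix N (int a - 1) then fls_shift (-1) (fls_const h) else 0)"
proof -
  have N: "0 < N" using a by simp
  define k0 where "k0 = (int a - 2) mod int N + 1"
  have k0: "k0 \<in> {1..int N}" using N by (simp add: k0_def add1_zle_eq)
  have dk0: "int N dvd int a - 1 - k0"
    by (metis (no_types, opaque_lifting) add_diff_cancel_right' diff_diff_eq dvd_minus_mod
        k0_def one_add_one diff_add_eq_diff_diff_swap)
  have uniq: "k = k0" if "k \<in> {1..int N}" "int N dvd int a - (k + 1)" for k
  proof -
    have "int N dvd (int a - 1 - k0) - (int a - (k + 1))"
      using dk0 that(2) by (rule dvd_diff)
    then have "int N dvd k - k0" by simp
    then have "k mod int N = k0 mod int N" by (simp add: mod_eq_dvd_iff)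
    then have "(k - 1) mod int N = (k0 - 1) mod int N" by (metis mod_diff_left_eq)
    then show ?thesis using that(1) k0 by simp
  qed
  have "(\<Sum>k = 1..int N. fls_shift (- 1) (fls_const h) * (munit N (k + 1) k $$ (a, b)))
      = (\<Sum>k = 1..int N. if k = k0 then
           (if b = ix N (int a - 1) then fls_shift (- 1) (fls_const h) else 0) else 0)"
  proof (rule sum.cong[OF refl])
    fix k assume k: "k \<in> {1..int N}"
    have eq: "a = ix N (k + 1) \<longleftrightarrow> k = k0"
    proof -
      have "a = ix N (k + 1) \<longleftrightarrow> int N dvd int a - (k + 1)"
        using ix_eq_iff[OF N, of "int a" "k + 1"] ix_of_nat[OF a] by simp
      also have "\<dots> \<longleftrightarrow> k = k0"
        using uniq[OF k] dk0 by (auto simp: algebra_simps)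
      finally show ?thesis .
    qed
    have "ix N k0 = ix N (int a - 1)"
      using dk0 by (metis ix_eq_iff[OF N])
    then show "fls_shift (- 1) (fls_const h) * (munit N (k + 1) k $$ (a, b)) =
      (if k = k0 then (if b = ix N (int a - 1) then fls_shift (- 1) (fls_const h) else 0) else 0)"
      using a b eq by (simp add: munit_def)
  qed
  also have "\<dots> = (if b = ix N (int a - 1) then fls_shift (- 1) (fls_const h) else 0)"
    using k0 by simp
  finally show ?thesis
    using a b by (simp add: Fmat_def lamsum_def)
qed

lemma Finv_nth:
  assumes "a < N" "b < N"
  shows "fls_nth (Finv N h $$ (a, b)) p =
    (if int N dvd p - (int a - int b) \<and> 0 \<le> p then h ^ nat p else 0)"
proof -
  have "Finv N h $$ (a, b) = Abs_fls (\<lambda>p. if int N dvd p - (int a - int b)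
      then (if 0 \<le> p then h ^ nat p else 0) else 0)"
    using assms by (simp add: Finv_def loop_def)
  then show ?thesis by (simp add: nth_Abs_fls_lower_bound[of 0])
qed

lemma Fmat_times_Finv:
  assumes N: "0 < N"
  shows "Fmat N h * Finv N h = 1\<^sub>m N"
proof (rule eq_matI)
  fix a b assume "a < dim_row (1\<^sub>m N :: real fls mat)" "b < dim_col (1\<^sub>m N :: real fls mat)"
  then have a: "a < N" and b: "b < N" by simp_all
  define a' where "a' = ix N (int a - 1)"
  have a': "a' < N" using N by (simp add: a'_def ix_def nat_less_iff)
  have da': "int N dvd int a - 1 - int a'"
    using ix_eq_iff[OF N, of "int a - 1" "int a'"] ix_of_nat[OF a'] by (simp add: a'_def)
  have dims: "dim_row (Fmat N h) = N" "dim_col (Fmat N h) = N"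
      "dim_row (Finv N h) = N" "dim_col (Finv N h) = N"
    by (simp_all add: Fmat_def lamsum_def Finv_def loop_def)
  have "(Fmat N h * Finv N h) $$ (a, b)
      = (\<Sum>c = 0..<N. Fmat N h $$ (a, c) * Finv N h $$ (c, b))"
    using a b dims by (simp add: scalar_prod_def)
  also have "\<dots> = (\<Sum>c = 0..<N. (if c = a then Finv N h $$ (c, b) else 0)
      - (if c = a' then fls_shift (-1) (fls_const h) * Finv N h $$ (c, b) else 0))"
    by (rule sum.cong) (use a in \<open>auto simp: Fmat_index a'_def left_diff_distrib\<close>)
  also have "\<dots> = Finv N h $$ (a, b) - fls_shift (-1) (fls_const h) * Finv N h $$ (a', b)"
    using a a' by (simp add: sum_subtractf)
  also have "\<dots> = (if a = b then 1 else 0)"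
  proof (rule fls_eqI)
    fix p
    have eqd: "int N dvd p - 1 - (int a' - int b) \<longleftrightarrow> int N dvd p - (int a - int b)"
    proof -
      have "p - 1 - (int a' - int b) = (p - (int a - int b)) + (int a - 1 - int a')" by simp
      then show ?thesis using dvd_add_left_iff[OF da'] by metis
    qed
    have ab: "a = b \<longleftrightarrow> int N dvd int b - int a"
      using ix_eq_iff[OF N, of "int b" "int a"] ix_of_nat[OF a] ix_of_nat[OF b] by auto
    have pw: "h * h ^ nat (p - 1) = h ^ nat p" if "1 \<le> p"
      using that by (metis Suc_nat_eq_nat_zadd1 add.commute diff_add_cancel diff_ge_0_iff_ge power_Suc)
    have "fls_nth (Finv N h $$ (a, b)
        - fls_shift (-1) (fls_const h) * Finv N h $$ (a', b)) p
      = fls_nth (Finv N h $$ (a, b)) p - h * fls_nth (Finv N h $$ (a', b)) (p - 1)"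
      by (simp add: fls_shifted_times_simps)
    also have "\<dots> = fls_nth (if a = b then 1 else 0) p"
      using a a' b eqd pw ab by (cases "p = 0") (auto simp: Finv_nth)
    finally show "fls_nth (Finv N h $$ (a, b)
        - fls_shift (-1) (fls_const h) * Finv N h $$ (a', b)) p
      = fls_nth (if a = b then 1 else 0) p" .
  qed
  finally show "(Fmat N h * Finv N h) $$ (a, b) = 1\<^sub>m N $$ (a, b)"
    using a b by simp
qed (simp_all add: Fmat_def lamsum_def Finv_def loop_def)

end

(* Let X_0, X_1, X_2, X_3 be the values of f at L_+ = F^-1 U W V, U W V F^-1, V F^-1 U W and
   W V F^-1 U. The factors are invertible at every phase point, so covariance of f gives
   X_1 F = F X_0, X_1 U = U X_3, X_3 W = W X_2 and X_2 V = V X_0. Hence, for instance,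
   pi_-(X_2) V - V pi_-(X_0) = V pi_+(X_0) - pi_+(X_2) V lives in degrees <= -1 and >= -1, so only
   in degree -1; with A_i = pi_-(X_i) + diagonal, all conditions reduce to the diagonal parts.
   Two compatible triples have the same A_1 since F is invertible. The other differences D satisfy
   two-term recurrences between consecutive degrees: the relations with U, V, W force D = 0 in
   degrees >= 0 when started from the top degree, and in negative degrees when started from the
   bottom one, the latter provided the coefficients do not vanish. Nondegenerate points being
   dense, continuous fields of compatible matrices are unique everywhere. *)

theory Submission
  imports Defs "Jordan_Normal_Form.Determinant"
begin

text \<open>Matrix entries are poor coordinates here: with E the cyclic shift times \<lambda>, the
  powers E^p and E^(p+N) occupy the same matrix positions and differ only in the power of \<lambda>.
  The argument therefore runs in the coefficients \<open>dcoef N X p k\<close> of the grading by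
  powers of E. In them a product is a convolution with shifted indices, each of U, V, W, F has only
  two terms, and every matrix condition becomes a relation between neighbouring degrees. The
  inverses of U, V, W do not depend continuously on the phase point: the inverse of I + diag(v) E^-1
  changes from negative to positive powers of E as soon as no v_k vanishes. They are used only
  pointwise, to turn cyclic permutation of the factors into conjugation. The continuous fields come
  from applying f to the four cyclic products, in which the constant F^-1 is the only
  inverse.\<close>

lemma periodic_cong:
  assumes "periodic N a" "int N dvd j - k"
  shows "a j = a k"
proof -
  have nat: "a (k + int n * int N) = a k" for k n
  proof (induction n)
    case (Suc n)
    have "a (k + int (Suc n) * int N) = a ((k + int n * int N) + int N)"
      by (simp add: algebra_simps)
    also have "\<dots> = a k"
      using assms(1) Suc.IH by (simp only: periodic_def)
    finally show ?case .
  qed simp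
  obtain q where q: "j - k = int N * q" using assms(2) by blast
  show ?thesis
  proof (cases "0 \<le> q")
    case True
    then show ?thesis using nat[of k "nat q"] q by (simp add: algebra_simps)
  next
    case False
    then show ?thesis using nat[of j "nat (- q)"] q by (simp add: algebra_simps)
  qed
qed

lemma periodic_shift: "periodic N a \<Longrightarrow> periodic N (\<lambda>k. a (k + j))"
  by (simp add: periodic_def) (metis add.assoc add.commute)

text \<open>The summation range is given by arbitrary lower bounds instead of the subdegrees. For a
  family depending on a phase point or on time one common range then serves all members, and sums
  can be treated term by term.\<close>

lemma fls_times_nth_bounded:
  fixes f g :: "real fls"
  assumes f: "\<And>p. p < m \<Longrightarrow> fls_nth f p = 0" and g: "\<And>p. p < n \<Longrightarrow> fls_nth g p = 0"
  shows "fls_nth (f * g) p = (\<Sum>q=m..p-n. fls_nth f q * fls_nth g (p - q))"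
proof -
  define S where "S = {fls_subdegree f..p - fls_subdegree g} \<union> {m..p-n}"
  have "fls_nth (f * g) p
      = (\<Sum>q=fls_subdegree f..p - fls_subdegree g. fls_nth f q * fls_nth g (p - q))"
    by (rule fls_times_nth)
  also have "\<dots> = (\<Sum>q\<in>S. fls_nth f q * fls_nth g (p - q))"
  proof (rule sum.mono_neutral_left)
    show "\<forall>i\<in>S - {fls_subdegree f..p - fls_subdegree g}. fls_nth f i * fls_nth g (p - i) = 0"
    proof
      fix i assume "i \<in> S - {fls_subdegree f..p - fls_subdegree g}"
      then have "i < fls_subdegree f \<or> p - i < fls_subdegree g" by auto
      then show "fls_nth f i * fls_nth g (p - i) = 0" by auto
    qed
  qed (auto simp: S_def)
  also have "\<dots> = (\<Sum>q=m..p-n. fls_nth f q * fls_nth g (p - q))"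
  proof (rule sum.mono_neutral_right)
    show "\<forall>i\<in>S - {m..p-n}. fls_nth f i * fls_nth g (p - i) = 0"
    proof
      fix i assume "i \<in> S - {m..p-n}"
      then have "i < m \<or> p - i < n" by auto
      then show "fls_nth f i * fls_nth g (p - i) = 0" using f g by auto
    qed
  qed (auto simp: S_def)
  finally show ?thesis .
qed

section \<open>Induction over degrees and two-term recurrences\<close>

lemma int_descent:
  fixes Q :: "int \<Rightarrow> bool"
  assumes m: "\<And>p. m < p \<Longrightarrow> Q p" and step: "\<And>p. c \<le> p \<Longrightarrow> Q (p + 1) \<Longrightarrow> Q p" and p: "c \<le> p"
  shows "Q p"
proof -
  have "Q p" if "c \<le> p" "nat (m - p) = n" for n p
    using that
  proof (induction n arbitrary: p)
    case 0
    then have "Q (p + 1)" by (intro m) simp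
    then show ?case using step 0 by blast
  next
    case (Suc n)
    then have "Q (p + 1)" by (intro Suc.IH) auto
    then show ?case using step Suc by blast
  qed
  then show ?thesis using p by blast
qed

lemma int_ascent:
  fixes Q :: "int \<Rightarrow> bool"
  assumes m: "\<And>p. p < m \<Longrightarrow> Q p" and step: "\<And>p. p \<le> c \<Longrightarrow> Q (p - 1) \<Longrightarrow> Q p" and p: "p \<le> c"
  shows "Q p"
proof -
  have "Q (- (- p))"
    by (rule int_descent[where Q = "\<lambda>p. Q (- p)" and m = "- m" and c = "- c"])
      (use assms in \<open>auto simp: algebra_simps\<close>)
  then show ?thesis by simp
qed

text \<open>The relation for p = -1 is missing because the equations of motion leave one degree
  free. Degrees above the gap are reached downwards from \<open>M\<close>, without division; degrees
  below it upwards from \<open>m\<close>, dividing by values of \<open>a\<close>.\<close>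

lemma bounded_recurrence_right_zero:
  fixes D :: "int \<Rightarrow> int \<Rightarrow> real"
  assumes top: "\<And>p k. M < p \<Longrightarrow> D p k = 0" and bot: "\<And>p k. p < m \<Longrightarrow> D p k = 0"
    and a: "\<And>k. a k \<noteq> 0"
    and rec: "\<And>p k. p \<noteq> -1 \<Longrightarrow> D p k + a (g p k) * D (p + 1) k = 0"
  shows "D p k = 0"
proof (cases "0 \<le> p")
  case True
  show ?thesis
  proof (rule int_descent[where Q = "\<lambda>p. D p k = 0" and c = 0 and m = M])
    fix p :: int assume "0 \<le> p" "D (p + 1) k = 0"
    then show "D p k = 0" using rec[of p k] by auto
  qed (use top True in auto)
next
  case False
  show ?thesis
  proof (rule int_ascent[where Q = "\<lambda>p. D p k = 0" and c = "-1" and m = m])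
    fix p :: int assume "p \<le> -1" "D (p - 1) k = 0"
    then show "D p k = 0" using rec[of "p - 1" k] a by auto
  qed (use bot False in auto)
qed

text \<open>Along the lines on which k - p is constant, this recurrence becomes the previous
  one.\<close>

lemma bounded_recurrence_left_zero:
  fixes D :: "int \<Rightarrow> int \<Rightarrow> real"
  assumes top: "\<And>p k. M < p \<Longrightarrow> D p k = 0" and bot: "\<And>p k. p < m \<Longrightarrow> D p k = 0"
    and a: "\<And>k. a k \<noteq> 0"
    and rec: "\<And>p k. p \<noteq> -1 \<Longrightarrow> D p k + a (g p k) * D (p + 1) (k + 1) = 0"
  shows "D p k = 0"
proof -
  have "D p (k - p + p) = 0"
  proof (rule bounded_recurrence_right_zero[where D = "\<lambda>p k. D p (k + p)" and M = M and m = m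
        and a = a and g = "\<lambda>p k. g p (k + p)"])
    fix p k :: int assume "p \<noteq> -1"
    then show "D p (k + p) + a (g p (k + p)) * D (p + 1) (k + (p + 1)) = 0"
      using rec[of p "k + p"] by (simp add: add.assoc)
  qed (use top bot a in auto)
  then show ?thesis by simp
qed

section \<open>The phase space and periodic families\<close>

lemma continuous_on_phase_coords [continuous_intros]:
  "continuous_on S (\<lambda>x::phase_pt. fst x k)"
  "continuous_on S (\<lambda>x::phase_pt. fst (snd x) k)"
  "continuous_on S (\<lambda>x::phase_pt. snd (snd x) k)"
  by (rule continuous_on_product_then_coordinatewise, intro continuous_intros)+

lemma phase_periodic:
  "x \<in> phase N \<Longrightarrow> periodic N (fst x)"
  "x \<in> phase N \<Longrightarrow> periodic N (fst (snd x))"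
  "x \<in> phase N \<Longrightarrow> periodic N (snd (snd x))"
  by (auto simp: phase_def)

text \<open>Common shape of the four first-flow matrices. Their terms with h \<gamma> are
  subtracted, so \<open>c\<close> is minus the coefficient in degree 0.\<close>

definition band :: "nat \<Rightarrow> (int \<Rightarrow> real) \<Rightarrow> (int \<Rightarrow> real) \<Rightarrow> (int \<Rightarrow> real) \<Rightarrow> real fls mat" where
  "band N a b c = lamsum N (-1) a (\<lambda>k. munit N k (k + 1)) + lamsum N (-2) b (\<lambda>k. munit N k (k + 2))
    - lamsum N 0 c (\<lambda>k. munit N k k)"

lemma periodicI: "(\<And>k. a (k + int N) = a k) \<Longrightarrow> periodic N a"
  by (simp add: periodic_def)

lemma periodic_simps:
  assumes "periodic N a"
  shows "a (k + int N) = a k" "a (k + int N + j) = a (k + j)" "a (k + int N - j) = a (k - j)"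
  by (rule periodic_cong[OF assms], simp)+

context
  fixes N :: nat
  assumes N: "0 < N"
begin

subsection \<open>The twisted loop algebra\<close>

lemma ix_less: "ix N k < N"
  using N by (simp add: ix_def nat_less_iff)

lemma dvd_ix: "int N dvd int (ix N k) - k"
  using ix_eq_iff[OF N, of "int (ix N k)" k] ix_of_nat[OF ix_less] by simp

lemma dvd_ix_diff: "int N dvd p - (int (ix N k) - int (ix N (k - p)))"
proof -
  have "p - (int (ix N k) - int (ix N (k - p))) = (int (ix N (k - p)) - (k - p)) - (int (ix N k) - k)"
    by simp
  then show ?thesis by (metis dvd_diff dvd_ix)
qed

lemma ix_cong: "int N dvd j - k \<Longrightarrow> ix N j = ix N k"
  by (simp add: ix_eq_iff[OF N])

lemma dcoef_cong: "int N dvd j - k \<Longrightarrow> dcoef N X p j = dcoef N X p k"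
  unfolding dcoef_def by (metis ix_cong diff_diff_eq2 diff_add_cancel add_diff_cancel_right)

lemma periodic_dcoef: "periodic N (dcoef N X p)"
  unfolding periodic_def by (intro allI dcoef_cong) simp

lemma ix_eqI: "j < N \<Longrightarrow> int N dvd k - int j \<Longrightarrow> ix N k = j"
  using ix_cong[of k "int j"] ix_of_nat[of j N] by simp

text \<open>Each entry has its own lowest degree; the minimum over the finitely many entries bounds
  all coefficients at once.\<close>

lemma dcoef_carrier_bounded:
  assumes "X \<in> carrier_mat N N"
  obtains m where "\<And>p k. p < m \<Longrightarrow> dcoef N X p k = 0"
proof
  fix p k assume p: "p < Min ((\<lambda>ij. fls_subdegree (X $$ ij)) ` ({..<N} \<times> {..<N}))"
  have "fls_subdegree (X $$ (ix N k, ix N (k - p)))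
      \<in> (\<lambda>ij. fls_subdegree (X $$ ij)) ` ({..<N} \<times> {..<N})"
    using ix_less by auto
  then have "Min ((\<lambda>ij. fls_subdegree (X $$ ij)) ` ({..<N} \<times> {..<N}))
      \<le> fls_subdegree (X $$ (ix N k, ix N (k - p)))"
    by (intro Min_le) auto
  with p show "dcoef N X p k = 0"
    by (simp add: dcoef_def)
qed

lemma loop_carrier: "loop N l \<in> carrier_mat N N"
  by (simp add: loop_def)

lemma nth_loop:
  assumes "\<And>p k. p < m \<Longrightarrow> l p k = 0" "i < N" "j < N"
  shows "fls_nth (loop N l $$ (i, j)) p = (if int N dvd p - (int i - int j) then l p (int i) else 0)"
  using assms by (simp add: loop_def nth_Abs_fls_lower_bound[of m])

text \<open>\<open>loop\<close> samples \<open>l p\<close> only at the representatives 0..N-1, so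
  without periodicity of \<open>l p\<close> only the value at the representative of k is
  recovered.\<close>

lemma dcoef_loop_ix:
  assumes "\<And>p k. p < m \<Longrightarrow> l p k = 0"
  shows "dcoef N (loop N l) p k = l p (int (ix N k))"
proof -
  have "int N dvd p - (int (ix N k) - int (ix N (k - p)))"
    by (rule dvd_ix_diff)
  then show ?thesis
    unfolding dcoef_def by (subst nth_loop[where m = m]) (use assms ix_less in auto)
qed

lemma dcoef_loop:
  assumes "\<And>p k. p < m \<Longrightarrow> l p k = 0" "\<And>p. periodic N (l p)"
  shows "dcoef N (loop N l) p k = l p k"
  using dcoef_loop_ix[of m l p k] assms periodic_cong[OF assms(2) dvd_ix] by simp

lemma loop_series_carrier: "X \<in> loop_series N \<Longrightarrow> X \<in> carrier_mat N N"
  by (auto simp: loop_series_def loop_carrier)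

lemma nth_loop_series:
  assumes "X \<in> loop_series N" "i < N" "j < N"
  shows "fls_nth (X $$ (i, j)) p = (if int N dvd p - (int i - int j) then dcoef N X p (int i) else 0)"
proof -
  obtain l m where X: "X = loop N l" and l: "\<And>p k. p < m \<Longrightarrow> l p k = 0"
    using assms(1) by (auto simp: loop_series_def)
  show ?thesis
    using nth_loop[OF l assms(2,3), where p = p] dcoef_loop_ix[OF l, where p = p and k = "int i"] ix_of_nat[OF assms(2)]
    by (simp add: X)
qed

text \<open>The twisting condition, that entry (i, j) carries only powers congruent to i - j mod N,
  already characterises the loop algebra: the family of coefficients of X serves as witness. Closure
  properties reduce to checking this grading.\<close>

lemma loop_seriesI:
  assumes X: "X \<in> carrier_mat N N"
    and gr: "\<And>i j p. i < N \<Longrightarrow> j < N \<Longrightarrow> \<not> int N dvd p - (int i - int j) \<Longrightarrow> fls_nth (X $$ (i, j)) p = 0"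
  shows "X \<in> loop_series N"
proof -
  obtain m where m: "\<And>p k. p < m \<Longrightarrow> dcoef N X p k = 0"
    using dcoef_carrier_bounded[OF X] by blast
  have "X = loop N (dcoef N X)"
  proof (rule eq_matI)
    fix i j assume "i < dim_row (loop N (dcoef N X))" "j < dim_col (loop N (dcoef N X))"
    then have ij: "i < N" "j < N" by (simp_all add: loop_def)
    show "X $$ (i, j) = loop N (dcoef N X) $$ (i, j)"
    proof (rule fls_eqI)
      fix p
      show "fls_nth (X $$ (i, j)) p = fls_nth (loop N (dcoef N X) $$ (i, j)) p"
      proof (cases "int N dvd p - (int i - int j)")
        case True
        then have "int N dvd (int i - p) - int j"
          by (metis diff_diff_eq2 diff_diff_add dvd_minus_iff minus_diff_eq add.commute)
        then have "ix N (int i - p) = j" using ix_eqI ij by blast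
        then show ?thesis
          by (subst nth_loop[where m = m, OF m ij])
            (use True ij in \<open>auto simp: dcoef_def ix_of_nat\<close>)
      next
        case False
        then show ?thesis
          by (subst nth_loop[where m = m, OF m ij]) (use gr[OF ij] in auto)
      qed
    qed
  qed (use X in \<open>auto simp: loop_def\<close>)
  then show ?thesis unfolding loop_series_def using m by blast
qed

lemma loop_series_bounded:
  assumes "X \<in> loop_series N"
  obtains m where "\<And>p k. p < m \<Longrightarrow> dcoef N X p k = 0"
  using dcoef_carrier_bounded[OF loop_series_carrier[OF assms]] by blast

lemma loop_series_eqI:
  assumes "X \<in> loop_series N" "Y \<in> loop_series N" "\<And>p k. dcoef N X p k = dcoef N Y p k"
  shows "X = Y"
proof (rule eq_matI)
  have c: "X \<in> carrier_mat N N" "Y \<in> carrier_mat N N"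
    using assms loop_series_carrier by auto
  fix i j assume "i < dim_row Y" "j < dim_col Y"
  then have ij: "i < N" "j < N" using c by auto
  show "X $$ (i, j) = Y $$ (i, j)"
    by (rule fls_eqI) (use assms ij in \<open>simp add: nth_loop_series\<close>)
qed (use loop_series_carrier[OF assms(1)] loop_series_carrier[OF assms(2)] in auto)

lemma loop_polyI:
  assumes X: "X \<in> loop_series N" and m: "\<And>p k. p > m \<Longrightarrow> dcoef N X p k = 0"
  shows "X \<in> loop_poly N"
proof -
  obtain m' where m': "\<And>p k. p < m' \<Longrightarrow> dcoef N X p k = 0" using loop_series_bounded[OF X] by blast
  have "loop N (dcoef N X) \<in> loop_series N"
    unfolding loop_series_def using m' by blast
  then have "X = loop N (dcoef N X)"
    by (rule loop_series_eqI[OF X]) (simp add: dcoef_loop[where m = m'] m' periodic_dcoef)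
  moreover have "\<forall>p. max m (- m') < \<bar>p\<bar> \<longrightarrow> (\<forall>k. dcoef N X p k = 0)"
  proof (intro allI impI)
    fix p k assume "max m (- m') < \<bar>p\<bar>"
    then have "p > m \<or> p < m'" by linarith
    then show "dcoef N X p k = 0" using m m' by auto
  qed
  ultimately show ?thesis unfolding loop_poly_def by blast
qed

lemma loop_poly_series: "X \<in> loop_poly N \<Longrightarrow> X \<in> loop_series N"
  unfolding loop_poly_def loop_series_def
  by clarsimp (metis abs_of_neg abs_ge_minus_self minus_less_iff neg_less_iff_less order_less_le_trans)

lemma loop_poly_bounded:
  assumes "X \<in> loop_poly N"
  obtains m where "\<And>p k. p > m \<Longrightarrow> dcoef N X p k = 0"
proof -
  obtain l m where X: "X = loop N l" and l: "\<And>p k. m < \<bar>p\<bar> \<Longrightarrow> l p k = 0"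
    using assms by (auto simp: loop_poly_def)
  have "dcoef N X p k = l p (int (ix N k))" for p k
    unfolding X by (rule dcoef_loop_ix[of "- \<bar>m\<bar>"]) (use l in auto)
  then show ?thesis using that[of m] l by simp
qed

section \<open>Sums and products as operations on coefficients\<close>

lemma dcoef_add:
  assumes "X \<in> loop_series N" "Y \<in> loop_series N"
  shows "dcoef N (X + Y) p k = dcoef N X p k + dcoef N Y p k"
  using assms[THEN loop_series_carrier] by (simp add: dcoef_def ix_less)

lemma dcoef_diff:
  assumes "X \<in> loop_series N" "Y \<in> loop_series N"
  shows "dcoef N (X - Y) p k = dcoef N X p k - dcoef N Y p k"
  using assms[THEN loop_series_carrier] by (simp add: dcoef_def ix_less)

lemma loop_series_add:
  assumes "X \<in> loop_series N" "Y \<in> loop_series N"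
  shows "X + Y \<in> loop_series N"
  by (rule loop_seriesI) (use assms assms[THEN loop_series_carrier] in \<open>auto simp: nth_loop_series\<close>)

lemma loop_series_diff:
  assumes "X \<in> loop_series N" "Y \<in> loop_series N"
  shows "X - Y \<in> loop_series N"
  by (rule loop_seriesI)
    (use assms assms[THEN loop_series_carrier] in \<open>auto simp: nth_loop_series minus_carrier_mat\<close>)

text \<open>For each degree q of the left factor the grading leaves a single intermediate index c,
  namely i - q mod N, so the double sum over c and q collapses. The index i - q of the second
  coefficient is the shift caused by moving a diagonal matrix across E^q.\<close>

lemma nth_mult_loop_series:
  assumes X: "X \<in> loop_series N" and Y: "Y \<in> loop_series N" and ij: "i < N" "j < N"
    and m: "\<And>p k. p < m \<Longrightarrow> dcoef N X p k = 0" and n: "\<And>p k. p < n \<Longrightarrow> dcoef N Y p k = 0"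
  shows "fls_nth ((X * Y) $$ (i, j)) p = (if int N dvd p - (int i - int j) then
    \<Sum>q=m..p-n. dcoef N X q (int i) * dcoef N Y (p - q) (int i - q) else 0)"
proof -
  have c: "X \<in> carrier_mat N N" "Y \<in> carrier_mat N N"
    using X Y loop_series_carrier by auto
  have "fls_nth ((X * Y) $$ (i, j)) p = (\<Sum>c<N. fls_nth (X $$ (i, c) * Y $$ (c, j)) p)"
    using c ij by (simp add: scalar_prod_def fls_nth_sum atLeast0LessThan)
  also have "\<dots> = (\<Sum>c<N. \<Sum>q=m..p-n. fls_nth (X $$ (i, c)) q * fls_nth (Y $$ (c, j)) (p - q))"
    by (intro sum.cong refl fls_times_nth_bounded) (use X Y ij m n in \<open>auto simp: nth_loop_series\<close>)
  also have "\<dots> = (\<Sum>q=m..p-n. \<Sum>c<N. fls_nth (X $$ (i, c)) q * fls_nth (Y $$ (c, j)) (p - q))"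
    by (rule sum.swap)
  also have "\<dots> = (\<Sum>q=m..p-n. \<Sum>c<N. if c = ix N (int i - q) then
      (if int N dvd p - (int i - int j) then dcoef N X q (int i) * dcoef N Y (p - q) (int i - q) else 0) else 0)"
  proof (intro sum.cong refl)
    fix q c assume c: "c \<in> {..<N}"
    have eq1: "int N dvd q - (int i - int c) \<longleftrightarrow> c = ix N (int i - q)"
    proof -
      have "int N dvd q - (int i - int c) \<longleftrightarrow> int N dvd (int i - q) - int c"
        by (metis dvd_minus_iff minus_diff_eq diff_diff_eq2 diff_diff_add add.commute)
      then show ?thesis using ix_eq_iff[OF N, of "int i - q" "int c"] ix_of_nat[of c N] c by auto
    qed
    have eq2: "int N dvd p - q - (int c - int j) \<longleftrightarrow> int N dvd p - (int i - int j)"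
      if "int N dvd q - (int i - int c)"
    proof -
      have "p - (int i - int j) = (p - q - (int c - int j)) + (q - (int i - int c))" by simp
      then show ?thesis using dvd_add_left_iff[OF that] by metis
    qed
    have eq3: "dcoef N Y (p - q) (int c) = dcoef N Y (p - q) (int i - q)"
      if "int N dvd q - (int i - int c)"
      by (rule dcoef_cong) (use that in \<open>simp add: algebra_simps\<close>)
    show "fls_nth (X $$ (i, c)) q * fls_nth (Y $$ (c, j)) (p - q) =
      (if c = ix N (int i - q) then
      (if int N dvd p - (int i - int j) then dcoef N X q (int i) * dcoef N Y (p - q) (int i - q) else 0) else 0)"
      using eq1 eq2 eq3 X Y ij c by (auto simp: nth_loop_series)
  qed
  also have "\<dots> = (if int N dvd p - (int i - int j) then
    \<Sum>q=m..p-n. dcoef N X q (int i) * dcoef N Y (p - q) (int i - q) else 0)"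
    using ix_less by simp
  finally show ?thesis .
qed

lemma loop_series_mult:
  assumes X: "X \<in> loop_series N" and Y: "Y \<in> loop_series N"
  shows "X * Y \<in> loop_series N"
proof -
  obtain m where m: "\<And>p k. p < m \<Longrightarrow> dcoef N X p k = 0" using loop_series_bounded[OF X] by blast
  obtain n where n: "\<And>p k. p < n \<Longrightarrow> dcoef N Y p k = 0" using loop_series_bounded[OF Y] by blast
  show ?thesis
    by (rule loop_seriesI)
      (use mult_carrier_mat[OF X[THEN loop_series_carrier] Y[THEN loop_series_carrier]] in
        \<open>auto simp: nth_mult_loop_series[OF X Y _ _ m n]\<close>)
qed

lemma dcoef_mult_bounded:
  assumes X: "X \<in> loop_series N" and Y: "Y \<in> loop_series N"
    and m: "\<And>p k. p < m \<Longrightarrow> dcoef N X p k = 0" and n: "\<And>p k. p < n \<Longrightarrow> dcoef N Y p k = 0"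
  shows "dcoef N (X * Y) p k = (\<Sum>q=m..p-n. dcoef N X q k * dcoef N Y (p - q) (k - q))"
proof -
  have d: "int N dvd p - (int (ix N k) - int (ix N (k - p)))"
    by (rule dvd_ix_diff)
  have "dcoef N (X * Y) p k
      = (\<Sum>q=m..p-n. dcoef N X q (int (ix N k)) * dcoef N Y (p - q) (int (ix N k) - q))"
    using d by (subst dcoef_def) (simp add: nth_mult_loop_series[OF X Y ix_less ix_less m n])
  also have "\<dots> = (\<Sum>q=m..p-n. dcoef N X q k * dcoef N Y (p - q) (k - q))"
    by (intro sum.cong refl arg_cong2[where f = "(*)"] dcoef_cong) (auto simp: dvd_ix)
  finally show ?thesis .
qed

text \<open>Any finite set containing the support may serve as range. If one factor has two terms,
  two degrees suffice, whatever the other factor is.\<close>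

lemma dcoef_mult:
  assumes X: "X \<in> loop_series N" and Y: "Y \<in> loop_series N" and S: "finite S"
    and z: "\<And>q. q \<notin> S \<Longrightarrow> dcoef N X q k * dcoef N Y (p - q) (k - q) = 0"
  shows "dcoef N (X * Y) p k = (\<Sum>q\<in>S. dcoef N X q k * dcoef N Y (p - q) (k - q))"
proof -
  obtain m where m: "\<And>p k. p < m \<Longrightarrow> dcoef N X p k = 0" using loop_series_bounded[OF X] by blast
  obtain n where n: "\<And>p k. p < n \<Longrightarrow> dcoef N Y p k = 0" using loop_series_bounded[OF Y] by blast
  have "dcoef N (X * Y) p k = (\<Sum>q=m..p-n. dcoef N X q k * dcoef N Y (p - q) (k - q))"
    by (rule dcoef_mult_bounded[OF X Y m n])
  also have "\<dots> = (\<Sum>q\<in>S \<union> {m..p-n}. dcoef N X q k * dcoef N Y (p - q) (k - q))"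
  proof (rule sum.mono_neutral_left)
    show "\<forall>q\<in>S \<union> {m..p-n} - {m..p-n}. dcoef N X q k * dcoef N Y (p - q) (k - q) = 0"
    proof
      fix q assume "q \<in> S \<union> {m..p-n} - {m..p-n}"
      then have "q < m \<or> p - q < n" by auto
      then show "dcoef N X q k * dcoef N Y (p - q) (k - q) = 0" using m n by auto
    qed
  qed (use S in auto)
  also have "\<dots> = (\<Sum>q\<in>S. dcoef N X q k * dcoef N Y (p - q) (k - q))"
    by (rule sum.mono_neutral_right) (use S z in auto)
  finally show ?thesis .
qed

section \<open>Homogeneous elements and the factors U, V, W, F\<close>

lemma nth_lamsum:
  assumes M: "\<And>k. M k = munit N (k + s) (k + s - q)" and ij: "i < N" "j < N"
  shows "fls_nth (lamsum N q c M $$ (i, j)) p =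
    (if p = q \<and> int N dvd q - (int i - int j) then c ((int i - s - 1) mod int N + 1) else 0)"
proof -
  \<comment> \<open>The sum runs over k = 1..N while rows are numbered 0..N-1. This is the only k in
    that range whose matrix unit, in row k + s, meets row i. The offset s is 1 for the units
    E_{k+1,k} and 0 for the others.\<close>
  define k0 where "k0 = (int i - s - 1) mod int N + 1"
  have k0: "k0 \<in> {1..int N}" using N by (simp add: k0_def add1_zle_eq)
  have "int N dvd (int i - s - 1) - (int i - s - 1) mod int N"
    by (rule dvd_minus_mod)
  then have dk0: "int N dvd int i - (k0 + s)" by (simp add: k0_def algebra_simps)
  have row: "i = ix N (k + s) \<longleftrightarrow> k = k0" if k: "k \<in> {1..int N}" for k
  proof
    assume "i = ix N (k + s)"
    then have "ix N (int i) = ix N (k + s)" using ix_of_nat[OF ij(1)] by simp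
    then have "int N dvd int i - (k + s)" using ix_eq_iff[OF N] by blast
    from dvd_diff[OF dk0 this] have "int N dvd (k - 1) - (k0 - 1)" by simp
    then have "(k - 1) mod int N = (k0 - 1) mod int N" by (simp add: mod_eq_dvd_iff)
    then show "k = k0" using k k0 by simp
  next
    assume "k = k0"
    then show "i = ix N (k + s)"
      using ix_eq_iff[OF N, of "int i" "k0 + s"] dk0 ix_of_nat[OF ij(1)] by simp
  qed
  have col: "j = ix N (k0 + s - q) \<longleftrightarrow> int N dvd q - (int i - int j)"
  proof -
    have "j = ix N (k0 + s - q) \<longleftrightarrow> int N dvd int j - (k0 + s - q)"
      using ix_eq_iff[OF N, of "int j" "k0 + s - q"] ix_of_nat[OF ij(2)] by simp
    also have "int j - (k0 + s - q) = (q - (int i - int j)) + (int i - (k0 + s))" by simp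
    finally show ?thesis using dvd_add_left_iff[OF dk0] by metis
  qed
  have "fls_nth (lamsum N q c M $$ (i, j)) p
      = (\<Sum>k=1..int N. fls_nth (fls_shift (- q) (fls_const (c k)) * (M k $$ (i, j))) p)"
    using ij by (simp add: lamsum_def fls_nth_sum)
  also have "\<dots> = (\<Sum>k=1..int N. if k = k0 then
      (if p = q \<and> int N dvd q - (int i - int j) then c k0 else 0) else 0)"
  proof (intro sum.cong refl)
    fix k assume k: "k \<in> {1..int N}"
    show "fls_nth (fls_shift (- q) (fls_const (c k)) * (M k $$ (i, j))) p = (if k = k0 then
      (if p = q \<and> int N dvd q - (int i - int j) then c k0 else 0) else 0)"
      using ij row[OF k] col by (auto simp: M munit_def)
  qed
  also have "\<dots> = (if p = q \<and> int N dvd q - (int i - int j) then c k0 else 0)"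
    using k0 by simp
  finally show ?thesis by (simp add: k0_def)
qed

lemma loop_series_lamsum:
  assumes "\<And>k. M k = munit N (k + s) (k + s - q)"
  shows "lamsum N q c M \<in> loop_series N"
proof (rule loop_seriesI)
  show "lamsum N q c M \<in> carrier_mat N N" by (simp add: lamsum_def)
qed (use nth_lamsum[OF assms] in auto)

lemma dcoef_lamsum_other:
  assumes "\<And>k. M k = munit N (k + s) (k + s - q)" "p \<noteq> q"
  shows "dcoef N (lamsum N q c M) p k = 0"
  unfolding dcoef_def by (subst nth_lamsum[OF assms(1)]) (use ix_less assms(2) in auto)

lemma dcoef_lamsum:
  assumes "\<And>k. M k = munit N (k + s) (k + s - q)" "periodic N c"
  shows "dcoef N (lamsum N q c M) p k = (if p = q then c (k - s) else 0)"
proof (cases "p = q")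
  case True
  have d: "int N dvd q - (int (ix N k) - int (ix N (k - q)))"
    by (rule dvd_ix_diff)
  have "int N dvd ((int (ix N k) - s - 1) mod int N + 1) - (k - s)"
  proof -
    have "int N dvd (int (ix N k) - s - 1) - (int (ix N k) - s - 1) mod int N"
      by (rule dvd_minus_mod)
    from dvd_diff[OF dvd_ix[of k] this] show ?thesis by (simp add: algebra_simps)
  qed
  then have "c ((int (ix N k) - s - 1) mod int N + 1) = c (k - s)"
    by (rule periodic_cong[OF assms(2)])
  then show ?thesis
    unfolding dcoef_def True by (subst nth_lamsum[OF assms(1)]) (use ix_less d in auto)
qed (simp add: dcoef_lamsum_other[OF assms(1)])

lemma lamsum_eqI:
  assumes M: "\<And>k. M k = munit N (k + s) (k + s - q)" and X: "X \<in> loop_series N"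
    and z: "\<And>p k. p \<noteq> q \<Longrightarrow> dcoef N X p k = 0"
  shows "X = lamsum N q (\<lambda>k. dcoef N X q (k + s)) M"
  by (rule loop_series_eqI[OF X loop_series_lamsum[OF M]])
    (simp add: dcoef_lamsum[OF M] periodic_shift periodic_dcoef z)

lemma one_eq_lamsum: "1\<^sub>m N = lamsum N 0 (\<lambda>_. 1) (\<lambda>k. munit N k k)"
proof (rule eq_matI)
  fix i j assume "i < dim_row (lamsum N 0 (\<lambda>_. 1) (\<lambda>k. munit N k k))"
    "j < dim_col (lamsum N 0 (\<lambda>_. 1) (\<lambda>k. munit N k k))"
  then have ij: "i < N" "j < N" by (auto simp: lamsum_def)
  have "int N dvd int j - int i \<longleftrightarrow> i = j"
    using ix_eq_iff[OF N, of "int j" "int i"] ix_of_nat ij by auto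
  then show "1\<^sub>m N $$ (i, j) = lamsum N 0 (\<lambda>_. 1) (\<lambda>k. munit N k k) $$ (i, j)"
    by (intro fls_eqI) (use ij in \<open>auto simp: nth_lamsum[where s = 0]\<close>)
qed (auto simp: lamsum_def)

lemma periodic_const: "periodic N (\<lambda>_. c)"
  by (simp add: periodic_def)

lemma loop_series_one: "1\<^sub>m N \<in> loop_series N"
  unfolding one_eq_lamsum by (rule loop_series_lamsum[where s = 0]) simp

lemma dcoef_one: "dcoef N (1\<^sub>m N) p k = (if p = 0 then 1 else 0)"
  unfolding one_eq_lamsum by (subst dcoef_lamsum[where s = 0]) (auto simp: periodic_const)

lemma loop_series_diag: "lamsum N 0 c (\<lambda>k. munit N k k) \<in> loop_series N"
  by (rule loop_series_lamsum[where s = 0]) simp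

lemma loop_series_up: "lamsum N (-1) c (\<lambda>k. munit N k (k + 1)) \<in> loop_series N"
  by (rule loop_series_lamsum[where s = 0]) simp

lemma loop_series_up2: "lamsum N (-2) c (\<lambda>k. munit N k (k + 2)) \<in> loop_series N"
  by (rule loop_series_lamsum[where s = 0]) simp

lemma loop_series_down: "lamsum N 1 c (\<lambda>k. munit N (k + 1) k) \<in> loop_series N"
  by (rule loop_series_lamsum[where s = 1]) simp

lemma dcoef_diag:
  "periodic N c \<Longrightarrow> dcoef N (lamsum N 0 c (\<lambda>k. munit N k k)) p k = (if p = 0 then c k else 0)"
  by (subst dcoef_lamsum[where s = 0]) auto

lemma dcoef_up:
  "periodic N c \<Longrightarrow>
    dcoef N (lamsum N (-1) c (\<lambda>k. munit N k (k + 1))) p k = (if p = -1 then c k else 0)"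
  by (subst dcoef_lamsum[where s = 0]) auto

lemma dcoef_up2:
  "periodic N c \<Longrightarrow>
    dcoef N (lamsum N (-2) c (\<lambda>k. munit N k (k + 2))) p k = (if p = -2 then c k else 0)"
  by (subst dcoef_lamsum[where s = 0]) auto

lemma dcoef_down:
  "periodic N c \<Longrightarrow>
    dcoef N (lamsum N 1 c (\<lambda>k. munit N (k + 1) k)) p k = (if p = 1 then c (k - 1) else 0)"
  by (subst dcoef_lamsum[where s = 1]) auto

lemma dcoef_diag_other: "p \<noteq> 0 \<Longrightarrow> dcoef N (lamsum N 0 c (\<lambda>k. munit N k k)) p k = 0"
  by (rule dcoef_lamsum_other[where s = 0]) auto

lemma dcoef_up_other: "p \<noteq> -1 \<Longrightarrow> dcoef N (lamsum N (-1) c (\<lambda>k. munit N k (k + 1))) p k = 0"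
  by (rule dcoef_lamsum_other[where s = 0]) auto

text \<open>The existential conditions in \<open>compatible\<close> turn into vanishing of all other
  degrees, the form in which both existence and uniqueness are proved.\<close>

lemma ex_diag_iff:
  "(\<exists>c. X = lamsum N 0 c (\<lambda>k. munit N k k)) \<longleftrightarrow>
    X \<in> loop_series N \<and> (\<forall>p k. p \<noteq> 0 \<longrightarrow> dcoef N X p k = 0)"
  using lamsum_eqI[where s = 0 and q = 0 and M = "\<lambda>k. munit N k k" and X = X]
    loop_series_diag dcoef_diag_other by auto

lemma ex_up_iff:
  "(\<exists>c. X = lamsum N (-1) c (\<lambda>k. munit N k (k + 1))) \<longleftrightarrow>
    X \<in> loop_series N \<and> (\<forall>p k. p \<noteq> -1 \<longrightarrow> dcoef N X p k = 0)"
  using lamsum_eqI[where s = 0 and q = "-1" and M = "\<lambda>k. munit N k (k + 1)" and X = X]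
    loop_series_up dcoef_up_other by auto

lemma loop_series_Umat: "Umat N u \<in> loop_series N"
  unfolding Umat_def by (intro loop_series_add N loop_series_diag loop_series_down)

lemma loop_series_Vmat: "Vmat N v \<in> loop_series N"
  unfolding Vmat_def by (intro loop_series_add N loop_series_one loop_series_up)

lemma Wmat_eq_Vmat: "Wmat N = Vmat N"
  by (rule ext) (simp add: Wmat_def Vmat_def)

lemma loop_series_Fmat: "Fmat N h \<in> loop_series N"
  unfolding Fmat_def by (intro loop_series_diff N loop_series_one loop_series_down)

lemma dcoef_Umat:
  "periodic N u \<Longrightarrow> dcoef N (Umat N u) p k = (if p = 0 then u k else if p = 1 then 1 else 0)"
  unfolding Umat_def
  by (simp add: dcoef_add loop_series_diag loop_series_down dcoef_diag dcoef_down periodic_const)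

lemma dcoef_Vmat:
  "periodic N v \<Longrightarrow> dcoef N (Vmat N v) p k = (if p = 0 then 1 else if p = -1 then v k else 0)"
  unfolding Vmat_def
  by (simp add: dcoef_add loop_series_one loop_series_up dcoef_one dcoef_up)

lemma dcoef_Fmat: "dcoef N (Fmat N h) p k = (if p = 0 then 1 else if p = 1 then - h else 0)"
  unfolding Fmat_def
  by (simp add: dcoef_diff loop_series_one loop_series_down dcoef_one dcoef_down periodic_const)

lemma dcoef_mult_two:
  assumes "X \<in> loop_series N" "Y \<in> loop_series N" "a \<noteq> b"
    and "\<And>q. q \<noteq> a \<Longrightarrow> q \<noteq> b \<Longrightarrow> dcoef N X q k * dcoef N Y (p - q) (k - q) = 0"
  shows "dcoef N (X * Y) p k =
    dcoef N X a k * dcoef N Y (p - a) (k - a) + dcoef N X b k * dcoef N Y (p - b) (k - b)"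
  using assms by (subst dcoef_mult[of X Y "{a, b}"]) auto

text \<open>The two sides behave differently because coefficients are written to the left of powers
  of E: a diagonal factor on the right is moved past E^p and read at k - p, whereas E on the left
  shifts the index of the coefficients of X.\<close>

lemma dcoef_mult_Umat:
  assumes "X \<in> loop_series N" "periodic N u"
  shows "dcoef N (X * Umat N u) p k = dcoef N X p k * u (k - p) + dcoef N X (p - 1) k"
  using assms
  by (subst dcoef_mult_two[where a = p and b = "p - 1"]) (auto simp: loop_series_Umat dcoef_Umat)

lemma dcoef_Umat_mult:
  assumes "X \<in> loop_series N" "periodic N u"
  shows "dcoef N (Umat N u * X) p k = u k * dcoef N X p k + dcoef N X (p - 1) (k - 1)"
  using assms
  by (subst dcoef_mult_two[where a = 0 and b = 1]) (auto simp: loop_series_Umat dcoef_Umat)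

lemma dcoef_mult_Vmat:
  assumes "X \<in> loop_series N" "periodic N v"
  shows "dcoef N (X * Vmat N v) p k = dcoef N X p k + dcoef N X (p + 1) k * v (k - p - 1)"
  using assms
  by (subst dcoef_mult_two[where a = p and b = "p + 1"])
    (auto simp: loop_series_Vmat dcoef_Vmat algebra_simps)

lemma dcoef_Vmat_mult:
  assumes "X \<in> loop_series N" "periodic N v"
  shows "dcoef N (Vmat N v * X) p k = dcoef N X p k + v k * dcoef N X (p + 1) (k + 1)"
  using assms
  by (subst dcoef_mult_two[where a = 0 and b = "-1"]) (auto simp: loop_series_Vmat dcoef_Vmat)

lemma dcoef_mult_Fmat:
  assumes "X \<in> loop_series N"
  shows "dcoef N (X * Fmat N h) p k = dcoef N X p k - h * dcoef N X (p - 1) k"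
  using assms
  by (subst dcoef_mult_two[where a = p and b = "p - 1"]) (auto simp: loop_series_Fmat dcoef_Fmat)

lemma dcoef_Fmat_mult:
  assumes "X \<in> loop_series N"
  shows "dcoef N (Fmat N h * X) p k = dcoef N X p k - h * dcoef N X (p - 1) (k - 1)"
  using assms
  by (subst dcoef_mult_two[where a = 0 and b = 1]) (auto simp: loop_series_Fmat dcoef_Fmat)

lemma loop_mem_series:
  assumes "\<And>p k. p < m \<Longrightarrow> l p k = 0"
  shows "loop N l \<in> loop_series N"
  unfolding loop_series_def using assms by blast

lemma loop_series_Finv: "Finv N h \<in> loop_series N"
  unfolding Finv_def by (rule loop_mem_series[of 0]) simp

lemma dcoef_Finv: "dcoef N (Finv N h) p k = (if 0 \<le> p then h ^ nat p else 0)"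
  unfolding Finv_def by (subst dcoef_loop[of 0]) (auto simp: periodic_const)

lemma Finv_times_Fmat: "Finv N h * Fmat N h = 1\<^sub>m N"
  by (rule mat_mult_left_right_inverse[OF loop_series_carrier loop_series_carrier])
    (simp_all add: loop_series_Fmat loop_series_Finv Fmat_times_Finv[OF N])

lemma loop_series_assoc:
  assumes "X \<in> loop_series N" "Y \<in> loop_series N" "Z \<in> loop_series N"
  shows "X * Y * Z = X * (Y * Z)"
  by (rule assoc_mult_mat) (rule assms[THEN loop_series_carrier])+

lemma loop_series_mult_one [simp]: "X \<in> loop_series N \<Longrightarrow> X * 1\<^sub>m N = X"
  by (rule right_mult_one_mat) (rule loop_series_carrier)

lemma loop_series_one_mult [simp]: "X \<in> loop_series N \<Longrightarrow> 1\<^sub>m N * X = X"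
  by (rule left_mult_one_mat) (rule loop_series_carrier)

subsection \<open>Invertible elements of the loop algebra\<close>

text \<open>The elements by which \<open>conj_covariant\<close> allows conjugation: the inverse has
  to lie in the loop algebra as well.\<close>

definition unit_loop :: "real fls mat \<Rightarrow> bool" where
  "unit_loop G \<longleftrightarrow> G \<in> loop_series N \<and> (\<exists>H\<in>loop_series N. G * H = 1\<^sub>m N \<and> H * G = 1\<^sub>m N)"

text \<open>Formal Laurent series over the reals form a field, so a one-sided inverse of a square
  matrix is two-sided.\<close>

lemma unit_loopI:
  assumes "G \<in> loop_series N" "H \<in> loop_series N" "G * H = 1\<^sub>m N"
  shows "unit_loop G"
  using mat_mult_left_right_inverse[OF loop_series_carrier[OF assms(1)]
      loop_series_carrier[OF assms(2)] assms(3)] assms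
  by (auto simp: unit_loop_def)

lemma unit_loop_Fmat: "unit_loop (Fmat N h)"
  by (rule unit_loopI[OF loop_series_Fmat loop_series_Finv Fmat_times_Finv[OF N]])

text \<open>The inverse of \<open>I + diag(v) \<E>\<^sup>-\<^sup>1\<close> is the geometric series in \<open>diag(v) \<E>\<^sup>-\<^sup>1\<close> if some \<open>v\<^sub>k\<close>
  vanishes, because the series then terminates; otherwise the expansion in positive powers is used.\<close>

lemma unit_loop_Vmat:
  assumes v: "periodic N v"
  shows "unit_loop (Vmat N v)"
proof (cases "\<exists>k. v k = 0")
  case True
  then obtain k0 where k0: "v k0 = 0" by blast
  \<comment> \<open>Coefficients of the geometric series: the n-th power of -diag(v) E^-1 has degree
    -n, and its k-th entry is, up to sign, the product of n consecutive values of v.\<close>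
  define l where "l p k = (if p \<le> 0 then (-1) ^ nat (-p) * (\<Prod>i<nat (-p). v (k + int i)) else 0)"
    for p k :: int
  \<comment> \<open>More than N consecutive indices contain one congruent to k0, where v
    vanishes.\<close>
  have l0: "l p k = 0" if "p < - int N" for p k
  proof -
    define i where "i = (k0 - k) mod int N"
    have i: "0 \<le> i" "i < int N" using N by (auto simp: i_def)
    have "int N dvd (k + i) - k0"
      by (metis add_diff_cancel_left' diff_diff_eq2 dvd_minus_mod dvd_minus_iff i_def minus_diff_eq add.commute)
    then have "v (k + int (nat i)) = 0"
      using periodic_cong[OF v] k0 i by simp
    moreover have "nat i < nat (- p)" using i that by simp
    ultimately have "(\<Prod>i<nat (- p). v (k + int i)) = 0"
      by (intro prod_zero bexI[of _ "nat i"]) auto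
    then show ?thesis by (simp add: l_def)
  qed
  have lper: "periodic N (l p)" for p
  proof -
    have "v (k + int N + int i) = v (k + int i)" for k i
      by (rule periodic_cong[OF v]) simp
    then show ?thesis by (simp add: periodic_def l_def)
  qed
  \<comment> \<open>This is V L = I in degree p.\<close>
  have rec: "l p k + v k * l (p + 1) (k + 1) = (if p = 0 then 1 else 0)" for p k
  proof (cases "p < 0")
    case True
    define n where "n = nat (- p - 1)"
    have n: "p = - 1 - int n" using True by (simp add: n_def)
    have "(\<Prod>i<Suc n. v (k + int i)) = v k * (\<Prod>i<n. v (k + 1 + int i))"
      by (subst prod.lessThan_Suc_shift) (simp add: algebra_simps)
    moreover have "nat (- p) = Suc n" "nat (- (p + 1)) = n" using n by auto
    ultimately show ?thesis using True by (simp add: l_def)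
  qed (auto simp: l_def)
  show ?thesis
  proof (rule unit_loopI[OF loop_series_Vmat loop_mem_series])
    show "l p k = 0" if "p < - int N" for p k by (rule l0[OF that])
    have L: "loop N l \<in> loop_series N" by (rule loop_mem_series[OF l0])
    show "Vmat N v * loop N l = 1\<^sub>m N"
      by (rule loop_series_eqI[OF loop_series_mult[OF loop_series_Vmat L] loop_series_one])
        (simp add: dcoef_Vmat_mult[OF L v] dcoef_loop[OF l0 lper] rec dcoef_one)
  qed
next
  case False
  then have nz: "v k \<noteq> 0" for k by blast
  \<comment> \<open>With Z = diag(v) E^-1 the inverse of I + Z is Z^-1 - Z^-2 + ..., and Z^-1 has
    the single coefficient 1 / v (k - 1) in degree 1. Hence the series starts at degree 1 and the
    indices run downwards.\<close>
  define l where "l p k = (if p \<ge> 1 then (-1) ^ nat (p - 1) * (\<Prod>i<nat p. 1 / v (k - 1 - int i)) else 0)"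
    for p k :: int
  have l0: "l p k = 0" if "p < 1" for p k using that by (simp add: l_def)
  have lper: "periodic N (l p)" for p
  proof -
    have "v (k + int N - 1 - int i) = v (k - 1 - int i)" for k i
      by (rule periodic_cong[OF v]) simp
    then show ?thesis by (simp add: periodic_def l_def)
  qed
  have rec: "l p k + v k * l (p + 1) (k + 1) = (if p = 0 then 1 else 0)" for p k
  proof (cases "p > 0")
    case True
    define n where "n = nat (p - 1)"
    have n: "p = 1 + int n" using True by (simp add: n_def)
    have "(\<Prod>i<Suc (Suc n). 1 / v (k + 1 - 1 - int i)) = 1 / v k * (\<Prod>i<Suc n. 1 / v (k - 1 - int i))"
      by (subst prod.lessThan_Suc_shift) (simp add: algebra_simps)
    moreover have "nat p = Suc n" "nat (p - 1) = n" "nat (p + 1 - 1) = Suc n" "nat (p + 1) = Suc (Suc n)"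
      using n by auto
    ultimately show ?thesis using True nz[of k] by (simp only: l_def) simp
  qed (use nz in \<open>auto simp: l_def\<close>)
  show ?thesis
  proof (rule unit_loopI[OF loop_series_Vmat loop_mem_series])
    show "l p k = 0" if "p < 1" for p k by (rule l0[OF that])
    have L: "loop N l \<in> loop_series N" by (rule loop_mem_series[OF l0])
    show "Vmat N v * loop N l = 1\<^sub>m N"
      by (rule loop_series_eqI[OF loop_series_mult[OF loop_series_Vmat L] loop_series_one])
        (simp add: dcoef_Vmat_mult[OF L v] dcoef_loop[OF l0 lper] rec dcoef_one)
  qed
qed

lemma unit_loop_mult:
  assumes "unit_loop G" "unit_loop G'"
  shows "unit_loop (G * G')"
proof -
  obtain H H' where H: "G \<in> loop_series N" "H \<in> loop_series N" "G * H = 1\<^sub>m N"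
    and H': "G' \<in> loop_series N" "H' \<in> loop_series N" "G' * H' = 1\<^sub>m N"
    using assms by (auto simp: unit_loop_def)
  have "G' * (H' * H) = H"
    using H H' loop_series_assoc[of G' H' H] by simp
  then have "G * G' * (H' * H) = 1\<^sub>m N"
    using H H' by (simp add: loop_series_assoc loop_series_mult)
  then show ?thesis
    using H H' by (intro unit_loopI[of _ "H' * H"]) (auto simp: loop_series_mult)
qed

text \<open>U = (I + diag(u) E^-1) E, so a factor of the shape of V and the invertible shift
  suffice.\<close>

lemma unit_loop_Umat:
  assumes u: "periodic N u"
  shows "unit_loop (Umat N u)"
proof -
  let ?E = "lamsum N 1 (\<lambda>_. 1) (\<lambda>k. munit N (k + 1) k)"
  let ?E' = "lamsum N (-1) (\<lambda>_. 1) (\<lambda>k. munit N k (k + 1))"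
  have E: "dcoef N (X * ?E) p k = dcoef N X (p - 1) k" if "X \<in> loop_series N" for X p k
    by (subst dcoef_mult[OF that loop_series_down, of "{p - 1}"])
      (auto simp: dcoef_down periodic_const)
  have "?E' * ?E = 1\<^sub>m N"
    by (rule loop_series_eqI[OF loop_series_mult[OF loop_series_up loop_series_down] loop_series_one])
      (auto simp: E loop_series_up dcoef_up periodic_const dcoef_one)
  then have "?E * ?E' = 1\<^sub>m N"
    by (rule mat_mult_left_right_inverse[OF loop_series_carrier[OF loop_series_up]
          loop_series_carrier[OF loop_series_down]])
  then have "unit_loop ?E"
    by (rule unit_loopI[OF loop_series_down loop_series_up])
  moreover have "Umat N u = Vmat N u * ?E"
    by (rule loop_series_eqI[OF loop_series_Umat loop_series_mult[OF loop_series_Vmat loop_series_down]])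
      (auto simp: E loop_series_Vmat dcoef_Vmat dcoef_Umat u)
  ultimately show ?thesis
    using unit_loop_mult[OF unit_loop_Vmat[OF u]] by simp
qed

text \<open>G Y = G (Y G) G^-1: moving a factor from one end of a product to the other is a
  conjugation.\<close>

lemma conj_covariant_intertwine:
  assumes f: "conj_covariant N f" and G: "unit_loop G" and Y: "Y \<in> loop_series N"
  shows "f (G * Y) * G = G * f (Y * G)"
proof -
  obtain H where H: "G \<in> loop_series N" "H \<in> loop_series N" "G * H = 1\<^sub>m N" "H * G = 1\<^sub>m N"
    using G by (auto simp: unit_loop_def)
  have YG: "Y * G \<in> loop_series N" "f (Y * G) \<in> loop_series N"
    using Y H f loop_series_mult by (auto simp: conj_covariant_def)
  have "G * (Y * G) * H = G * Y"
    using H Y by (simp add: loop_series_assoc loop_series_mult)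
  then have "f (G * Y) = G * f (Y * G) * H"
    using f YG H by (metis conj_covariant_def)
  then show ?thesis
    using H YG by (simp add: loop_series_assoc loop_series_mult)
qed

subsection \<open>Existence of compatible matrices\<close>

lemma dcoef_pi_minus:
  assumes "X \<in> loop_series N"
  shows "dcoef N (pi_minus N X) p k = (if p < 0 then dcoef N X p k else 0)"
proof -
  obtain m where "\<And>p k. p < m \<Longrightarrow> dcoef N X p k = 0" using loop_series_bounded[OF assms] by blast
  then show ?thesis
    unfolding pi_minus_def
    by (subst dcoef_loop[of m])
      (use periodic_dcoef[of X] in \<open>auto simp: periodic_def\<close>)
qed

lemma loop_series_pi_minus:
  assumes "X \<in> loop_series N"
  shows "pi_minus N X \<in> loop_series N"
proof -
  obtain m where "\<And>p k. p < m \<Longrightarrow> dcoef N X p k = 0" using loop_series_bounded[OF assms] by blast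
  then show ?thesis unfolding pi_minus_def by (intro loop_mem_series[of m]) simp
qed

definition sigma_coef :: "real \<Rightarrow> real fls mat \<Rightarrow> int \<Rightarrow> real" where
  "sigma_coef h X k = (\<Sum>p | p < 0 \<and> dcoef N X p k \<noteq> 0. h ^ nat (- p) * dcoef N X p k)"

text \<open>The sum over nonzero coefficients has an index set that varies with X. A fixed range is
  what telescoping and continuity require.\<close>

lemma sigma_coef_bounded:
  assumes "\<And>p k. p < - int M \<Longrightarrow> dcoef N X p k = 0"
  shows "sigma_coef h X k = (\<Sum>n=1..M. h ^ n * dcoef N X (- int n) k)"
proof -
  have "sigma_coef h X k = (\<Sum>p\<in>{- int M..-1}. h ^ nat (- p) * dcoef N X p k)"
    unfolding sigma_coef_def
  proof (rule sum.mono_neutral_left)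
    show "{p. p < 0 \<and> dcoef N X p k \<noteq> 0} \<subseteq> {- int M..-1}"
      using assms by (auto simp: not_less[symmetric])
  qed auto
  also have "\<dots> = (\<Sum>n=1..M. h ^ n * dcoef N X (- int n) k)"
    by (rule sum.reindex_bij_witness[of _ "\<lambda>n. - int n" "\<lambda>p. nat (- p)"]) auto
  finally show ?thesis .
qed

lemma periodic_sigma_coef: "periodic N (sigma_coef h X)"
proof -
  have "dcoef N X p (k + int N) = dcoef N X p k" for p k
    by (rule dcoef_cong) simp
  then show ?thesis by (simp add: periodic_def sigma_coef_def)
qed

lemma sigma_eq: "sigma N h X = lamsum N 0 (sigma_coef h X) (\<lambda>k. munit N k k)"
  by (simp add: sigma_def sigma_coef_def[abs_def])

text \<open>All compatible matrices constructed below have this form; only the diagonal d remains to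
  be chosen.\<close>

definition lax_part :: "real fls mat \<Rightarrow> (int \<Rightarrow> real) \<Rightarrow> real fls mat" where
  "lax_part X d = pi_minus N X + lamsum N 0 d (\<lambda>k. munit N k k)"

lemma dcoef_lax_part:
  assumes "X \<in> loop_series N" "periodic N d"
  shows "dcoef N (lax_part X d) p k = (if p < 0 then dcoef N X p k else if p = 0 then d k else 0)"
  using assms unfolding lax_part_def
  by (simp add: dcoef_add loop_series_pi_minus loop_series_diag dcoef_pi_minus dcoef_diag)

lemma loop_series_lax_part: "X \<in> loop_series N \<Longrightarrow> lax_part X d \<in> loop_series N"
  unfolding lax_part_def by (intro loop_series_add N loop_series_pi_minus loop_series_diag)

lemma loop_poly_lax_part: "X \<in> loop_series N \<Longrightarrow> periodic N d \<Longrightarrow> lax_part X d \<in> loop_poly N"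
  by (rule loop_polyI[OF loop_series_lax_part, of _ 0]) (auto simp: dcoef_lax_part)

lemma pi_minus_sigma_eq_lax_part:
  assumes "X \<in> loop_series N"
  shows "pi_minus N X - sigma N h X = lax_part X (\<lambda>k. - sigma_coef h X k)"
proof -
  have "periodic N (\<lambda>k. - sigma_coef h X k)"
    using periodic_sigma_coef[of h X] by (simp add: periodic_def)
  then show ?thesis
    using assms
    by (intro loop_series_eqI)
      (simp_all add: dcoef_diff loop_series_diff loop_series_pi_minus sigma_eq
        loop_series_diag dcoef_pi_minus dcoef_diag periodic_sigma_coef
        loop_series_lax_part dcoef_lax_part)
qed

text \<open>Below degree -1 only negative coefficients of X and Y enter, so the relation X V = V Y
  survives truncation. In degree 0 the two diagonals cancel because they are equal, and above it
  nothing is left.\<close>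

lemma ex_up_lax_part:
  assumes X: "X \<in> loop_series N" and Y: "Y \<in> loop_series N" and v: "periodic N v" and d: "periodic N d"
    and XY: "X * Vmat N v = Vmat N v * Y"
  shows "\<exists>c. lax_part X d * Vmat N v - Vmat N v * lax_part Y d
    = lamsum N (-1) c (\<lambda>k. munit N k (k + 1))"
proof -
  have eq: "dcoef N X p k + dcoef N X (p + 1) k * v (k - p - 1)
      = dcoef N Y p k + v k * dcoef N Y (p + 1) (k + 1)" for p k
    using arg_cong[OF XY, of "\<lambda>X. dcoef N X p k"] X Y v
    by (simp add: dcoef_mult_Vmat dcoef_Vmat_mult)
  have "dcoef N (lax_part X d * Vmat N v - Vmat N v * lax_part Y d) p k = 0" if "p \<noteq> -1" for p k
    using that X Y v d eq[of p k]
    by (simp add: dcoef_diff loop_series_mult loop_series_Vmat loop_series_lax_part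
        dcoef_mult_Vmat dcoef_Vmat_mult dcoef_lax_part)
  then show ?thesis
    unfolding ex_up_iff
    using X Y by (simp add: loop_series_diff loop_series_mult loop_series_Vmat
        loop_series_lax_part)
qed

text \<open>In negative degrees the relation X U = U Y survives truncation. In degree 1 the summand
  E of U meets the diagonals from both sides and shifts the right one; giving the left one the
  argument k - 1 makes them cancel.\<close>

lemma ex_diag_lax_part:
  assumes X: "X \<in> loop_series N" and Y: "Y \<in> loop_series N" and u: "periodic N u" and d: "periodic N d"
    and XY: "X * Umat N u = Umat N u * Y"
  shows "\<exists>c. lax_part X (\<lambda>k. d (k - 1)) * Umat N u - Umat N u * lax_part Y d
    = lamsum N 0 c (\<lambda>k. munit N k k)"
proof -
  have d': "periodic N (\<lambda>k. d (k - 1))" using periodic_shift[OF d, of "-1"] by simp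
  have eq: "dcoef N X p k * u (k - p) + dcoef N X (p - 1) k
      = u k * dcoef N Y p k + dcoef N Y (p - 1) (k - 1)" for p k
    using arg_cong[OF XY, of "\<lambda>X. dcoef N X p k"] X Y u
    by (simp add: dcoef_mult_Umat dcoef_Umat_mult)
  have "dcoef N (lax_part X (\<lambda>k. d (k - 1)) * Umat N u - Umat N u * lax_part Y d) p k = 0"
    if "p \<noteq> 0" for p k
    using that X Y u d d' eq[of p k]
    by (simp add: dcoef_diff loop_series_mult loop_series_Umat loop_series_lax_part
        dcoef_mult_Umat dcoef_Umat_mult dcoef_lax_part)
  then show ?thesis
    unfolding ex_diag_iff
    using X Y by (simp add: loop_series_diff loop_series_mult loop_series_Umat
        loop_series_lax_part)
qed

text \<open>In degree 0 the claim is \<open>\<sigma>(X)\<^sub>k - \<sigma>(X)\<^sub>k\<^sub>-\<^sub>1 = h (Y\<^sub>-\<^sub>1 - X\<^sub>-\<^sub>1)\<close>, a telescoping sum of the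
  relations \<open>Y \<F> = \<F> X\<close> in the negative degrees; this is what determines \<open>\<sigma>\<close>.\<close>

lemma lax_part_Fmat:
  assumes X: "X \<in> loop_series N" and Y: "Y \<in> loop_series N"
    and YX: "Y * Fmat N h = Fmat N h * X"
  shows "lax_part Y (\<lambda>k. - sigma_coef h X (k - 1)) * Fmat N h
    = Fmat N h * lax_part X (\<lambda>k. - sigma_coef h X k)"
proof -
  have d: "periodic N (\<lambda>k. - sigma_coef h X k)"
    using periodic_sigma_coef[of h X] by (simp add: periodic_def)
  have d': "periodic N (\<lambda>k. - sigma_coef h X (k - 1))"
    using periodic_shift[OF d, of "-1"] by simp
  have eq: "dcoef N Y p k - h * dcoef N Y (p - 1) k = dcoef N X p k - h * dcoef N X (p - 1) (k - 1)"
    for p k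
    using arg_cong[OF YX, of "\<lambda>X. dcoef N X p k"] X Y
    by (simp add: dcoef_mult_Fmat dcoef_Fmat_mult)
  obtain m where m: "\<And>p k. p < m \<Longrightarrow> dcoef N X p k = 0" using loop_series_bounded[OF X] by blast
  obtain n where n: "\<And>p k. p < n \<Longrightarrow> dcoef N Y p k = 0" using loop_series_bounded[OF Y] by blast
  define M where "M = nat (max (- m) (- n))"
  have MX: "dcoef N X p k = 0" if "p < - int M" for p k by (rule m) (use that in \<open>auto simp: M_def max_def split: if_splits\<close>)
  have MY: "dcoef N Y p k = 0" if "p < - int M" for p k by (rule n) (use that in \<open>auto simp: M_def max_def split: if_splits\<close>)
  \<comment> \<open>Using the relation in degree -j, each summand is a difference of consecutive
    remainders. At J = M the remainder lies below the common bound of X and Y and vanishes.\<close>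
  have "(\<Sum>j=1..J. h ^ j * (dcoef N X (- int j) k - dcoef N X (- int j) (k - 1)))
      = h * (dcoef N Y (-1) k - dcoef N X (-1) (k - 1))
        - h ^ Suc J * (dcoef N Y (- int (Suc J)) k - dcoef N X (- int (Suc J)) (k - 1))" for J k
  proof (induction J)
    case (Suc J)
    have "dcoef N X (- int (Suc J)) k = dcoef N Y (- int (Suc J)) k
        - h * dcoef N Y (- int (Suc (Suc J))) k + h * dcoef N X (- int (Suc (Suc J))) (k - 1)"
      using eq[of "- int (Suc J)" k] by (simp add: algebra_simps)
    then have "h ^ Suc J * (dcoef N X (- int (Suc J)) k - dcoef N X (- int (Suc J)) (k - 1))
        = h ^ Suc J * (dcoef N Y (- int (Suc J)) k - dcoef N X (- int (Suc J)) (k - 1))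
          - h ^ Suc (Suc J) * (dcoef N Y (- int (Suc (Suc J))) k - dcoef N X (- int (Suc (Suc J))) (k - 1))"
      by (simp only: power_Suc) (simp add: algebra_simps)
    then show ?case
      using Suc.IH by (simp only: sum.cl_ivl_Suc) simp
  qed simp
  from this[where J = M] have tel: "sigma_coef h X k - sigma_coef h X (k - 1)
      = h * (dcoef N Y (-1) k - dcoef N X (-1) (k - 1))" for k
    using MX MY
    by (simp add: sigma_coef_bounded[where M = M] sum_subtractf[symmetric] right_diff_distrib[symmetric]
        del: power_Suc of_nat_Suc)
  have "dcoef N (lax_part Y (\<lambda>k. - sigma_coef h X (k - 1)) * Fmat N h) p k
      = dcoef N (Fmat N h * lax_part X (\<lambda>k. - sigma_coef h X k)) p k" for p k
  proof -
    \<comment> \<open>Negative degrees are the relation Y F = F X itself, degree 0 is the telescoped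
      identity, and in degree 1 the shifted diagonal matches the E in F.\<close>
    consider "p < 0" | "p = 0" | "p = 1" | "p > 1" by linarith
    then show ?thesis
      using X Y d d' eq[of p k] tel[of k]
      by cases (simp_all add: dcoef_mult_Fmat dcoef_Fmat_mult loop_series_lax_part
          dcoef_lax_part algebra_simps)
  qed
  then show ?thesis
    using X Y by (intro loop_series_eqI)
      (simp_all add: loop_series_mult loop_series_Fmat loop_series_lax_part)
qed

section \<open>The four cyclic Lax matrices\<close>

definition lax0 where "lax0 h f u v w = f (Lplus N h u v w)"
text \<open>The brackets in \<open>lax1\<close>, \<open>lax2\<close> and \<open>lax3\<close> isolate
  the first factor as G in G * Y, ready for \<open>conj_covariant_intertwine\<close>.\<close>

definition lax1 where "lax1 h f u v w = f (Umat N u * (Wmat N w * (Vmat N v * Finv N h)))"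
definition lax2 where "lax2 h f u v w = f (Vmat N v * (Finv N h * Umat N u * Wmat N w))"
definition lax3 where "lax3 h f u v w = f (Wmat N w * (Vmat N v * (Finv N h * Umat N u)))"

lemma loop_series_Wmat: "Wmat N w \<in> loop_series N"
  by (simp add: Wmat_eq_Vmat loop_series_Vmat)

lemma loop_series_Lplus: "Lplus N h u v w \<in> loop_series N"
  unfolding Lplus_def
  by (intro loop_series_mult N loop_series_Finv loop_series_Umat loop_series_Wmat loop_series_Vmat)

lemma loop_series_lax:
  assumes "conj_covariant N f"
  shows "lax0 h f u v w \<in> loop_series N" "lax1 h f u v w \<in> loop_series N"
    "lax2 h f u v w \<in> loop_series N" "lax3 h f u v w \<in> loop_series N"
  using assms unfolding conj_covariant_def lax0_def lax1_def lax2_def lax3_def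
  by (simp_all add: loop_series_Lplus loop_series_mult loop_series_Finv loop_series_Umat
      loop_series_Wmat loop_series_Vmat)

lemma lax_intertwine:
  assumes f: "conj_covariant N f" and u: "periodic N u" and v: "periodic N v" and w: "periodic N w"
  shows "lax1 h f u v w * Fmat N h = Fmat N h * lax0 h f u v w"
    and "lax1 h f u v w * Umat N u = Umat N u * lax3 h f u v w"
    and "lax3 h f u v w * Wmat N w = Wmat N w * lax2 h f u v w"
    and "lax2 h f u v w * Vmat N v = Vmat N v * lax0 h f u v w"
proof -
  note ls = loop_series_Lplus loop_series_mult loop_series_Finv loop_series_Umat
      loop_series_Wmat loop_series_Vmat loop_series_Fmat
  note as = loop_series_assoc
  show "lax2 h f u v w * Vmat N v = Vmat N v * lax0 h f u v w"
    unfolding lax2_def lax0_def Lplus_def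
    by (rule conj_covariant_intertwine[OF f unit_loop_Vmat[OF v]]) (simp add: ls)
  have "Vmat N v * (Finv N h * Umat N u * Wmat N w) = Vmat N v * (Finv N h * Umat N u) * Wmat N w"
    by (simp add: ls as)
  then show "lax3 h f u v w * Wmat N w = Wmat N w * lax2 h f u v w"
    unfolding lax2_def lax3_def
    by (simp only:) (rule conj_covariant_intertwine[OF f],
        simp_all add: ls unit_loop_Vmat w Wmat_eq_Vmat)
  have "Wmat N w * (Vmat N v * (Finv N h * Umat N u)) = Wmat N w * (Vmat N v * Finv N h) * Umat N u"
    by (simp add: ls as)
  then show "lax1 h f u v w * Umat N u = Umat N u * lax3 h f u v w"
    unfolding lax1_def lax3_def
    by (simp only:) (rule conj_covariant_intertwine[OF f unit_loop_Umat[OF u]], simp add: ls)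
  have FF: "Fmat N h * (Finv N h * Z) = Z" if "Z \<in> loop_series N" for Z
    using that as[of "Fmat N h" "Finv N h" Z] by (simp add: ls Fmat_times_Finv[OF N] loop_series_one_mult)
  \<comment> \<open>With G = F and Y = L_+ F^-1, the products G Y and Y G are U W V F^-1 and
    L_+.\<close>
  have eq1: "Umat N u * (Wmat N w * (Vmat N v * Finv N h)) = Fmat N h * (Lplus N h u v w * Finv N h)"
    unfolding Lplus_def by (simp add: ls as FF)
  have eq2: "Lplus N h u v w = Lplus N h u v w * Finv N h * Fmat N h"
    by (simp add: ls as Finv_times_Fmat loop_series_mult_one)
  have "f (Fmat N h * (Lplus N h u v w * Finv N h)) * Fmat N h
      = Fmat N h * f (Lplus N h u v w * Finv N h * Fmat N h)"
    by (rule conj_covariant_intertwine[OF f unit_loop_Fmat]) (simp add: ls)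
  then show "lax1 h f u v w * Fmat N h = Fmat N h * lax0 h f u v w"
    unfolding lax1_def lax0_def eq1 using eq2 by simp
qed

lemma A0mat_eq:
  assumes "conj_covariant N f"
  shows "A0mat N h f u v w = lax_part (lax0 h f u v w) (\<lambda>k. - sigma_coef h (lax0 h f u v w) k)"
  using pi_minus_sigma_eq_lax_part[OF loop_series_lax(1)[OF assms]] by (simp add: A0mat_def lax0_def)

lemma compatible_lax_part:
  fixes h :: real
  assumes f: "conj_covariant N f" and u: "periodic N u" and v: "periodic N v" and w: "periodic N w"
  defines "s \<equiv> sigma_coef h (lax0 h f u v w)"
  shows "compatible N h f u v w (lax_part (lax1 h f u v w) (\<lambda>k. - s (k - 1)))
    (lax_part (lax2 h f u v w) (\<lambda>k. - s k)) (lax_part (lax3 h f u v w) (\<lambda>k. - s k))"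
proof -
  have d: "periodic N (\<lambda>k. - s k)"
    using periodic_sigma_coef by (simp add: periodic_def s_def)
  have d': "periodic N (\<lambda>k. - s (k - 1))"
    using periodic_shift[OF d, of "-1"] by simp
  note X = loop_series_lax[OF f, of h u v w] and eq = lax_intertwine[OF f u v w, of h]
  show ?thesis
    unfolding compatible_def A0mat_eq[OF f]
    using loop_poly_lax_part[OF X(2) d'] loop_poly_lax_part[OF X(3) d] loop_poly_lax_part[OF X(4) d]
      lax_part_Fmat[OF X(1) X(2) eq(1)] ex_diag_lax_part[OF X(2) X(4) u d eq(2)]
      ex_up_lax_part[OF X(4) X(3) w d eq(3)[unfolded Wmat_eq_Vmat]]
      ex_up_lax_part[OF X(3) X(1) v d eq(4)]
    by (simp add: s_def Wmat_eq_Vmat)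
qed

subsection \<open>Uniqueness and continuous fields\<close>

lemma compatible_degrees:
  assumes c: "compatible N h f u v w A1 A2 A3" and u: "periodic N u" and v: "periodic N v" and w: "periodic N w"
    and A0: "A0mat N h f u v w \<in> loop_series N"
  shows "p \<noteq> 0 \<Longrightarrow> dcoef N A1 p k * u (k - p) + dcoef N A1 (p - 1) k
      = u k * dcoef N A3 p k + dcoef N A3 (p - 1) (k - 1)"
    and "p \<noteq> -1 \<Longrightarrow> dcoef N A2 p k + dcoef N A2 (p + 1) k * v (k - p - 1)
      = dcoef N (A0mat N h f u v w) p k + v k * dcoef N (A0mat N h f u v w) (p + 1) (k + 1)"
    and "p \<noteq> -1 \<Longrightarrow> dcoef N A3 p k + dcoef N A3 (p + 1) k * w (k - p - 1)
      = dcoef N A2 p k + w k * dcoef N A2 (p + 1) (k + 1)"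
proof -
  have A: "A1 \<in> loop_series N" "A2 \<in> loop_series N" "A3 \<in> loop_series N"
    using c loop_poly_series by (auto simp: compatible_def)
  note ls = loop_series_mult loop_series_Umat loop_series_Vmat loop_series_Wmat
  have U: "\<forall>p k. p \<noteq> 0 \<longrightarrow> dcoef N (A1 * Umat N u - Umat N u * A3) p k = 0"
    using c unfolding compatible_def ex_diag_iff by blast
  have V: "\<forall>p k. p \<noteq> -1 \<longrightarrow> dcoef N (A2 * Vmat N v - Vmat N v * A0mat N h f u v w) p k = 0"
    and W: "\<forall>p k. p \<noteq> -1 \<longrightarrow> dcoef N (A3 * Wmat N w - Wmat N w * A2) p k = 0"
    using c unfolding compatible_def ex_up_iff by blast+
  show "dcoef N A1 p k * u (k - p) + dcoef N A1 (p - 1) k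
      = u k * dcoef N A3 p k + dcoef N A3 (p - 1) (k - 1)" if "p \<noteq> 0"
    using U[rule_format, OF that, of k] A u
    by (simp add: dcoef_diff ls dcoef_mult_Umat dcoef_Umat_mult)
  show "dcoef N A2 p k + dcoef N A2 (p + 1) k * v (k - p - 1)
      = dcoef N (A0mat N h f u v w) p k + v k * dcoef N (A0mat N h f u v w) (p + 1) (k + 1)" if "p \<noteq> -1"
    using V[rule_format, OF that, of k] A A0 v
    by (simp add: dcoef_diff ls dcoef_mult_Vmat dcoef_Vmat_mult)
  show "dcoef N A3 p k + dcoef N A3 (p + 1) k * w (k - p - 1)
      = dcoef N A2 p k + w k * dcoef N A2 (p + 1) (k + 1)" if "p \<noteq> -1"
    using W[rule_format, OF that, of k] A w
    by (simp add: dcoef_diff ls dcoef_mult_Vmat dcoef_Vmat_mult Wmat_eq_Vmat)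
qed

lemma loop_poly_diff_bounded:
  assumes "X \<in> loop_poly N" "Y \<in> loop_poly N"
  obtains M m where "\<And>p k. M < p \<Longrightarrow> dcoef N X p k - dcoef N Y p k = 0"
    "\<And>p k. p < m \<Longrightarrow> dcoef N X p k - dcoef N Y p k = 0"
proof -
  note s = assms[THEN loop_poly_series]
  obtain M1 where "\<And>p k. M1 < p \<Longrightarrow> dcoef N X p k = 0" using loop_poly_bounded[OF assms(1)] by blast
  moreover obtain M2 where "\<And>p k. M2 < p \<Longrightarrow> dcoef N Y p k = 0" using loop_poly_bounded[OF assms(2)] by blast
  moreover obtain m1 where "\<And>p k. p < m1 \<Longrightarrow> dcoef N X p k = 0" using loop_series_bounded[OF s(1)] by blast
  moreover obtain m2 where "\<And>p k. p < m2 \<Longrightarrow> dcoef N Y p k = 0" using loop_series_bounded[OF s(2)] by blast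
  ultimately show ?thesis by (intro that[of "max M1 M2" "min m1 m2"]) simp_all
qed

text \<open>The matrices form a chain A1 - A3 - A2 - A0 whose links are the relations with U, W, V,
  and both ends are known. A link whose coefficients have no zero transports uniqueness from one end
  to the other. If one link is degenerate, the other two still reach A2 and A3, from one end or from
  both; this is what \<open>nondegenerate\<close> expresses.\<close>

lemma compatible_unique:
  assumes f: "conj_covariant N f" and u: "periodic N u" and v: "periodic N v" and w: "periodic N w"
    and nd: "nondegenerate u v w"
    and A: "compatible N h f u v w A1 A2 A3" and B: "compatible N h f u v w B1 B2 B3"
  shows "A1 = B1 \<and> A2 = B2 \<and> A3 = B3"
proof -
  have A0: "A0mat N h f u v w \<in> loop_series N"
    unfolding A0mat_eq[OF f] by (intro loop_series_lax_part N loop_series_lax f)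
  have lp: "A1 \<in> loop_poly N" "A2 \<in> loop_poly N" "A3 \<in> loop_poly N"
      "B1 \<in> loop_poly N" "B2 \<in> loop_poly N" "B3 \<in> loop_poly N"
    using A B by (auto simp: compatible_def)
  note ls = lp[THEN loop_poly_series]
  note ad = compatible_degrees[OF A u v w A0] and bd = compatible_degrees[OF B u v w A0]
  have "A1 * Fmat N h * Finv N h = B1 * Fmat N h * Finv N h"
    using A B by (simp add: compatible_def)
  then have 1: "A1 = B1"
    using ls by (simp add: loop_series_assoc loop_series_Fmat loop_series_Finv
        Fmat_times_Finv[OF N] loop_series_mult_one)
  obtain m2 M2 where b2: "\<And>p k. M2 < p \<Longrightarrow> dcoef N A2 p k - dcoef N B2 p k = 0"
    "\<And>p k. p < m2 \<Longrightarrow> dcoef N A2 p k - dcoef N B2 p k = 0"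
    by (rule loop_poly_diff_bounded[OF lp(2,5)]) (rule that)
  obtain m3 M3 where b3: "\<And>p k. M3 < p \<Longrightarrow> dcoef N A3 p k - dcoef N B3 p k = 0"
    "\<And>p k. p < m3 \<Longrightarrow> dcoef N A3 p k - dcoef N B3 p k = 0"
    by (rule loop_poly_diff_bounded[OF lp(3,6)]) (rule that)
  \<comment> \<open>A1 = B1 cancels, leaving U (A3 - B3) = 0 in degree p + 1. The free degree 0 of
    this relation becomes the missing p = -1.\<close>
  have U: "A3 = B3" if "\<forall>k. u k \<noteq> 0"
  proof -
    have "dcoef N A3 p k - dcoef N B3 p k = 0" for p k
    proof (rule bounded_recurrence_left_zero[where D = "\<lambda>p k. dcoef N A3 p k - dcoef N B3 p k"
          and M = M3 and m = m3 and a = u and g = "\<lambda>p k. k + 1"])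
      fix p k :: int assume "p \<noteq> -1"
      then show "dcoef N A3 p k - dcoef N B3 p k
          + u (k + 1) * (dcoef N A3 (p + 1) (k + 1) - dcoef N B3 (p + 1) (k + 1)) = 0"
        using ad(1)[of "p + 1" "k + 1"] bd(1)[of "p + 1" "k + 1"] 1
        by (simp add: algebra_simps)
    qed (use b3 that in auto)
    then show ?thesis by (intro loop_series_eqI[OF ls(3,6)]) simp
  qed
  \<comment> \<open>Here the common A0 cancels, V stands on the right, and the free degree is -1
    without a shift.\<close>
  have V: "A2 = B2" if "\<forall>k. v k \<noteq> 0"
  proof -
    have "dcoef N A2 p k - dcoef N B2 p k = 0" for p k
    proof (rule bounded_recurrence_right_zero[where D = "\<lambda>p k. dcoef N A2 p k - dcoef N B2 p k"
          and M = M2 and m = m2 and a = v and g = "\<lambda>p k. k - p - 1"])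
      fix p k :: int assume "p \<noteq> -1"
      then show "dcoef N A2 p k - dcoef N B2 p k
          + v (k - p - 1) * (dcoef N A2 (p + 1) k - dcoef N B2 (p + 1) k) = 0"
        using ad(2)[of p k] bd(2)[of p k] by (simp add: algebra_simps)
    qed (use b2 that in auto)
    then show ?thesis by (intro loop_series_eqI[OF ls(2,5)]) simp
  qed
  have W3: "A3 = B3" if "\<forall>k. w k \<noteq> 0" "A2 = B2"
  proof -
    have "dcoef N A3 p k - dcoef N B3 p k = 0" for p k
    proof (rule bounded_recurrence_right_zero[where D = "\<lambda>p k. dcoef N A3 p k - dcoef N B3 p k"
          and M = M3 and m = m3 and a = w and g = "\<lambda>p k. k - p - 1"])
      fix p k :: int assume "p \<noteq> -1"
      then show "dcoef N A3 p k - dcoef N B3 p k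
          + w (k - p - 1) * (dcoef N A3 (p + 1) k - dcoef N B3 (p + 1) k) = 0"
        using ad(3)[of p k] bd(3)[of p k] that(2) by (simp add: algebra_simps)
    qed (use b3 that in auto)
    then show ?thesis by (intro loop_series_eqI[OF ls(3,6)]) simp
  qed
  have W2: "A2 = B2" if "\<forall>k. w k \<noteq> 0" "A3 = B3"
  proof -
    have "dcoef N A2 p k - dcoef N B2 p k = 0" for p k
    proof (rule bounded_recurrence_left_zero[where D = "\<lambda>p k. dcoef N A2 p k - dcoef N B2 p k"
          and M = M2 and m = m2 and a = w and g = "\<lambda>p k. k"])
      fix p k :: int assume "p \<noteq> -1"
      then show "dcoef N A2 p k - dcoef N B2 p k
          + w k * (dcoef N A2 (p + 1) (k + 1) - dcoef N B2 (p + 1) (k + 1)) = 0"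
        using ad(3)[of p k] bd(3)[of p k] that(2) by (simp add: algebra_simps)
    qed (use b2 that in auto)
    then show ?thesis by (intro loop_series_eqI[OF ls(2,5)]) simp
  qed
  show ?thesis using nd 1 U V W2 W3 unfolding nondegenerate_def by metis
qed

section \<open>Continuous fields on the phase space\<close>

lemma cont_fieldI:
  assumes "\<And>x. x \<in> phase N \<Longrightarrow> X x \<in> loop_series N"
    and "\<And>x p k. x \<in> phase N \<Longrightarrow> p < m \<Longrightarrow> dcoef N (X x) p k = 0"
    and "\<And>p k. continuous_on (phase N) (\<lambda>x. dcoef N (X x) p k)"
  shows "cont_field N X"
  unfolding cont_field_def by (intro conjI exI[of _ m] ballI allI impI assms)

lemma cont_fieldE:
  assumes "cont_field N X"
  obtains m where "\<And>x. x \<in> phase N \<Longrightarrow> X x \<in> loop_series N"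
    and "\<And>x p k. x \<in> phase N \<Longrightarrow> p < m \<Longrightarrow> dcoef N (X x) p k = 0"
    and "\<And>p k. continuous_on (phase N) (\<lambda>x. dcoef N (X x) p k)"
proof -
  obtain m where "\<forall>x\<in>phase N. \<forall>p<m. \<forall>k. dcoef N (X x) p k = 0"
    using assms by (auto simp: cont_field_def)
  then show ?thesis using assms by (intro that[of m]) (auto simp: cont_field_def)
qed

text \<open>The uniform lower bounds in \<open>cont_field\<close> give one finite convolution range
  for all phase points, so each coefficient is a finite sum of products of continuous
  functions.\<close>

lemma cont_field_mult:
  assumes X: "cont_field N X" and Y: "cont_field N Y"
  shows "cont_field N (\<lambda>x. X x * Y x)"
proof -
  obtain m where m: "\<And>x. x \<in> phase N \<Longrightarrow> X x \<in> loop_series N"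
    "\<And>x p k. x \<in> phase N \<Longrightarrow> p < m \<Longrightarrow> dcoef N (X x) p k = 0"
    "\<And>p k. continuous_on (phase N) (\<lambda>x. dcoef N (X x) p k)" using cont_fieldE[OF X] by metis
  obtain n where n: "\<And>x. x \<in> phase N \<Longrightarrow> Y x \<in> loop_series N"
    "\<And>x p k. x \<in> phase N \<Longrightarrow> p < n \<Longrightarrow> dcoef N (Y x) p k = 0"
    "\<And>p k. continuous_on (phase N) (\<lambda>x. dcoef N (Y x) p k)" using cont_fieldE[OF Y] by metis
  have eq: "dcoef N (X x * Y x) p k = (\<Sum>q=m..p-n. dcoef N (X x) q k * dcoef N (Y x) (p - q) (k - q))"
    if "x \<in> phase N" for x p k
    by (rule dcoef_mult_bounded) (use m n that in auto)
  show ?thesis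
  proof (rule cont_fieldI[where m = "m + n"])
    fix p k
    have "continuous_on (phase N)
        (\<lambda>x. \<Sum>q=m..p-n. dcoef N (X x) q k * dcoef N (Y x) (p - q) (k - q))"
      by (intro continuous_intros m n)
    then show "continuous_on (phase N) (\<lambda>x. dcoef N (X x * Y x) p k)"
      by (rule continuous_on_eq) (simp add: eq)
  qed (use m n in \<open>auto simp: eq loop_series_mult\<close>)
qed

lemma cont_field_const:
  assumes "A \<in> loop_series N"
  shows "cont_field N (\<lambda>x. A)"
proof -
  obtain m where "\<And>p k. p < m \<Longrightarrow> dcoef N A p k = 0" using loop_series_bounded[OF assms] by blast
  then show ?thesis using assms by (intro cont_fieldI) auto
qed

lemma cont_field_Umat: "cont_field N (\<lambda>x. Umat N (fst x))"
proof (rule cont_fieldI[where m = 0])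
  fix p k :: int
  have "continuous_on (phase N) (\<lambda>x. if p = 0 then fst x k else if p = 1 then 1 else 0)"
    by (cases "p = 0"; cases "p = 1") (auto intro: continuous_intros)
  then show "continuous_on (phase N) (\<lambda>x. dcoef N (Umat N (fst x)) p k)"
    by (rule continuous_on_eq) (simp add: dcoef_Umat phase_periodic)
qed (auto simp: loop_series_Umat dcoef_Umat phase_periodic)

lemma cont_field_Vmat:
  assumes "\<And>k. continuous_on (phase N) (\<lambda>x. g x k)" "\<And>x. x \<in> phase N \<Longrightarrow> periodic N (g x)"
  shows "cont_field N (\<lambda>x. Vmat N (g x))"
proof (rule cont_fieldI[where m = "-1"])
  fix p k :: int
  have "continuous_on (phase N) (\<lambda>x. if p = 0 then 1 else if p = -1 then g x k else 0)"
    by (cases "p = 0"; cases "p = -1") (auto intro: continuous_intros assms)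
  then show "continuous_on (phase N) (\<lambda>x. dcoef N (Vmat N (g x)) p k)"
    by (rule continuous_on_eq) (simp add: dcoef_Vmat assms)
qed (auto simp: loop_series_Vmat dcoef_Vmat assms)

lemma cont_field_lax:
  assumes f: "cont_preserving N f"
  shows "cont_field N (\<lambda>x. lax0 h f (fst x) (fst (snd x)) (snd (snd x)))"
    "cont_field N (\<lambda>x. lax1 h f (fst x) (fst (snd x)) (snd (snd x)))"
    "cont_field N (\<lambda>x. lax2 h f (fst x) (fst (snd x)) (snd (snd x)))"
    "cont_field N (\<lambda>x. lax3 h f (fst x) (fst (snd x)) (snd (snd x)))"
proof -
  have f': "cont_field N (\<lambda>x. f (X x))" if "cont_field N X" for X
    using f that by (simp add: cont_preserving_def)
  have V: "cont_field N (\<lambda>x. Vmat N (fst (snd x)))" and W: "cont_field N (\<lambda>x. Wmat N (snd (snd x)))"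
    unfolding Wmat_eq_Vmat
    by (rule cont_field_Vmat, intro continuous_intros, erule phase_periodic)+
  note c = f' cont_field_mult cont_field_Umat V W cont_field_const[OF loop_series_Finv]
  show "cont_field N (\<lambda>x. lax0 h f (fst x) (fst (snd x)) (snd (snd x)))"
    "cont_field N (\<lambda>x. lax1 h f (fst x) (fst (snd x)) (snd (snd x)))"
    "cont_field N (\<lambda>x. lax2 h f (fst x) (fst (snd x)) (snd (snd x)))"
    "cont_field N (\<lambda>x. lax3 h f (fst x) (fst (snd x)) (snd (snd x)))"
    unfolding lax0_def lax1_def lax2_def lax3_def Lplus_def
    by (intro c)+
qed

lemma cont_field_lax_part:
  assumes X: "cont_field N X" and d: "\<And>k. continuous_on (phase N) (\<lambda>x. d x k)"
    and per: "\<And>x. x \<in> phase N \<Longrightarrow> periodic N (d x)"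
  shows "cont_field N (\<lambda>x. lax_part (X x) (d x))"
proof -
  obtain m where m: "\<And>x. x \<in> phase N \<Longrightarrow> X x \<in> loop_series N"
    "\<And>x p k. x \<in> phase N \<Longrightarrow> p < m \<Longrightarrow> dcoef N (X x) p k = 0"
    "\<And>p k. continuous_on (phase N) (\<lambda>x. dcoef N (X x) p k)" using cont_fieldE[OF X] by metis
  show ?thesis
  proof (rule cont_fieldI[where m = "min m 0"])
    fix p k
    have "continuous_on (phase N) (\<lambda>x. if p < 0 then dcoef N (X x) p k else if p = 0 then d x k else 0)"
      by (cases "p < 0"; cases "p = 0") (auto intro: continuous_intros m d)
    then show "continuous_on (phase N) (\<lambda>x. dcoef N (lax_part (X x) (d x)) p k)"
      by (rule continuous_on_eq) (simp add: dcoef_lax_part m per)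
  qed (auto simp: loop_series_lax_part dcoef_lax_part m per)
qed

lemma continuous_on_sigma_coef:
  assumes X: "cont_field N X"
  shows "continuous_on (phase N) (\<lambda>x. sigma_coef h (X x) k)"
proof -
  obtain m where m: "\<And>x p k. x \<in> phase N \<Longrightarrow> p < m \<Longrightarrow> dcoef N (X x) p k = 0"
    "\<And>p k. continuous_on (phase N) (\<lambda>x. dcoef N (X x) p k)" using cont_fieldE[OF X] by metis
  have "continuous_on (phase N) (\<lambda>x. \<Sum>n=1..nat (-m). h ^ n * dcoef N (X x) (- int n) k)"
    by (intro continuous_intros m)
  then show ?thesis
  proof (rule continuous_on_eq)
    fix x assume x: "x \<in> phase N"
    show "(\<Sum>n=1..nat (-m). h ^ n * dcoef N (X x) (- int n) k) = sigma_coef h (X x) k"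
      \<comment> \<open>For positive m the range is empty, which is right since all negative degrees
        vanish.\<close>
      by (rule sigma_coef_bounded[symmetric], rule m(1)[OF x]) (auto split: if_splits)
  qed
qed

lemma ex_compatible_fields:
  assumes f: "conj_covariant N f" and cf: "cont_preserving N f"
  shows "\<exists>A1 A2 A3. compatible_fields N h f A1 A2 A3"
proof -
  define s where "s x = sigma_coef h (lax0 h f (fst x) (fst (snd x)) (snd (snd x)))" for x
  have s: "continuous_on (phase N) (\<lambda>x. - s x k)" "continuous_on (phase N) (\<lambda>x. - s x (k - 1))" for k
    unfolding s_def by (intro continuous_intros continuous_on_sigma_coef cont_field_lax cf)+
  have per: "periodic N (\<lambda>k. - s x k)" for x
    using periodic_sigma_coef by (simp add: s_def periodic_def)
  have per': "periodic N (\<lambda>k. - s x (k - 1))" for x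
    using periodic_shift[OF per[of x], of "-1"] by simp
  show ?thesis
  proof (intro exI)
    show "compatible_fields N h f
      (\<lambda>x. lax_part (lax1 h f (fst x) (fst (snd x)) (snd (snd x))) (\<lambda>k. - s x (k - 1)))
      (\<lambda>x. lax_part (lax2 h f (fst x) (fst (snd x)) (snd (snd x))) (\<lambda>k. - s x k))
      (\<lambda>x. lax_part (lax3 h f (fst x) (fst (snd x)) (snd (snd x))) (\<lambda>k. - s x k))"
      unfolding compatible_fields_def
    proof (intro conjI ballI)
      fix x assume x: "x \<in> phase N"
      obtain u v w where uvw: "x = (u, v, w)" by (metis prod_cases3)
      show "case x of (u, v, w) \<Rightarrow> compatible N h f u v w
        (lax_part (lax1 h f (fst (u, v, w)) (fst (snd (u, v, w))) (snd (snd (u, v, w))))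
          (\<lambda>k. - s (u, v, w) (k - 1)))
        (lax_part (lax2 h f (fst (u, v, w)) (fst (snd (u, v, w))) (snd (snd (u, v, w))))
          (\<lambda>k. - s (u, v, w) k))
        (lax_part (lax3 h f (fst (u, v, w)) (fst (snd (u, v, w))) (snd (snd (u, v, w))))
          (\<lambda>k. - s (u, v, w) k))"
        using compatible_lax_part[OF f phase_periodic[OF x], of h] by (simp add: uvw s_def)
    qed (intro cont_field_lax_part cont_field_lax cf s per per')+
  qed
qed

text \<open>The nondegenerate points are dense: \<open>(u + \<epsilon>, v + \<epsilon>, w + \<epsilon>)\<close> is nondegenerate for all small
  \<open>\<epsilon> \<noteq> 0\<close>.\<close>

lemma compatible_fields_unique:
  assumes f: "conj_covariant N f"
    and A: "compatible_fields N h f A1 A2 A3" and B: "compatible_fields N h f B1 B2 B3"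
    and x: "x \<in> phase N"
  shows "A1 x = B1 x \<and> A2 x = B2 x \<and> A3 x = B3 x"
proof -
  define g :: "real \<Rightarrow> phase_pt" where
    "g e = (\<lambda>k. fst x k + e, \<lambda>k. fst (snd x) k + e, \<lambda>k. snd (snd x) k + e)" for e
  have gp: "g e \<in> phase N" for e
    using phase_periodic[OF x] by (simp add: g_def phase_def periodic_def)
  have g0: "g 0 = x" by (simp add: g_def)
  have gc: "continuous_on UNIV g"
    unfolding g_def by (intro continuous_intros)
  \<comment> \<open>By periodicity only finitely many values of e, the -a k of one period, have to
    be avoided.\<close>
  have ev: "eventually (\<lambda>e. \<forall>k. a k + e \<noteq> 0) (at 0)" if a: "periodic N a" for a
  proof -
    have "eventually (\<lambda>e. \<forall>k\<in>{0..<int N}. e \<noteq> - a k) (at 0)"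
      by (intro eventually_ball_finite ballI eventually_neq_at_within) simp
    then show ?thesis
    proof eventually_elim
      case (elim e)
      show ?case
      proof
        fix k
        have "k mod int N \<in> {0..<int N}" using N by simp
        moreover have "a k = a (k mod int N)"
          by (rule periodic_cong[OF a]) (rule dvd_minus_mod)
        ultimately show "a k + e \<noteq> 0" using elim by (metis add.commute eq_neg_iff_add_eq_0)
      qed
    qed
  qed
  have comp: "compatible N h f (fst y) (fst (snd y)) (snd (snd y)) (A1 y) (A2 y) (A3 y)"
    "compatible N h f (fst y) (fst (snd y)) (snd (snd y)) (B1 y) (B2 y) (B3 y)" if "y \<in> phase N" for y
    using A B that by (auto simp: compatible_fields_def case_prod_beta)
  have eq: "eventually (\<lambda>e. A1 (g e) = B1 (g e) \<and> A2 (g e) = B2 (g e) \<and> A3 (g e) = B3 (g e)) (at 0)"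
    using ev[OF phase_periodic(1)[OF x]] ev[OF phase_periodic(2)[OF x]]
  proof eventually_elim
    case (elim e)
    then have "nondegenerate (fst (g e)) (fst (snd (g e))) (snd (snd (g e)))"
      by (simp add: nondegenerate_def g_def)
    then show ?case
      by (rule compatible_unique[OF f phase_periodic[OF gp] _ comp[OF gp]])
  qed
  \<comment> \<open>Along g both fields converge to their values at x, and they agree near e = 0 off
    0, so the limits coincide.\<close>
  have lim: "X x = Y x" if X: "cont_field N X" and Y: "cont_field N Y"
    and ev: "eventually (\<lambda>e. X (g e) = Y (g e)) (at 0)" for X Y
  proof (rule loop_series_eqI)
    show "X x \<in> loop_series N" "Y x \<in> loop_series N" using X Y x by (auto simp: cont_field_def)
    fix p k
    have tends: "((\<lambda>e. dcoef N (Z (g e)) p k) \<longlongrightarrow> dcoef N (Z x) p k) (at 0)" if "cont_field N Z" for Z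
    proof -
      have "continuous_on (phase N) (\<lambda>y. dcoef N (Z y) p k)" using that by (simp add: cont_field_def)
      then have "continuous_on UNIV (\<lambda>e. dcoef N (Z (g e)) p k)"
        by (rule continuous_on_compose2[OF _ gc]) (use gp in auto)
      then have "isCont (\<lambda>e. dcoef N (Z (g e)) p k) 0"
        by (simp add: continuous_on_eq_continuous_at)
      then show ?thesis by (simp add: isCont_def g0)
    qed
    have "((\<lambda>e. dcoef N (Y (g e)) p k) \<longlongrightarrow> dcoef N (X x) p k) (at 0)"
      by (rule Lim_transform_eventually[OF tends[OF X]]) (use ev in eventually_elim, simp)
    then show "dcoef N (X x) p k = dcoef N (Y x) p k"
      using tends[OF Y] by (rule tendsto_unique[rotated]) simp
  qed
  have cA: "cont_field N A1" "cont_field N A2" "cont_field N A3"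
    and cB: "cont_field N B1" "cont_field N B2" "cont_field N B3"
    using A B by (auto simp: compatible_fields_def)
  show ?thesis
    using lim[OF cA(1) cB(1)] lim[OF cA(2) cB(2)] lim[OF cA(3) cB(3)] eq
    by (simp add: eventually_conj_iff)
qed

subsection \<open>Lax triads along curves\<close>

text \<open>Positions and powers that violate the grading carry the constant 0 on both
  sides.\<close>

lemma has_mat_deriv_loop:
  assumes X: "\<And>s. X s \<in> loop_series N" and D: "D \<in> loop_series N"
  shows "has_mat_deriv N X D t \<longleftrightarrow>
    (\<forall>p k. ((\<lambda>s. dcoef N (X s) p k) has_real_derivative dcoef N D p k) (at t))"
proof
  assume "has_mat_deriv N X D t"
  then show "\<forall>p k. ((\<lambda>s. dcoef N (X s) p k) has_real_derivative dcoef N D p k) (at t)"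
    unfolding has_mat_deriv_def dcoef_def using ix_less by blast
next
  assume *: "\<forall>p k. ((\<lambda>s. dcoef N (X s) p k) has_real_derivative dcoef N D p k) (at t)"
  show "has_mat_deriv N X D t"
    unfolding has_mat_deriv_def
  proof (intro allI impI)
    fix i j p assume ij: "i < N" "j < N"
    show "((\<lambda>s. fls_nth (X s $$ (i, j)) p) has_real_derivative fls_nth (D $$ (i, j)) p) (at t)"
      using * by (cases "int N dvd p - (int i - int j)")
        (simp_all add: nth_loop_series[OF X ij] nth_loop_series[OF D ij])
  qed
qed

lemma has_mat_deriv_mult:
  assumes X: "\<And>s. X s \<in> loop_series N" "D \<in> loop_series N" "has_mat_deriv N X D t"
    and m: "\<And>s p k. p < m \<Longrightarrow> dcoef N (X s) p k = 0"
    and Y: "\<And>s. Y s \<in> loop_series N" "E \<in> loop_series N" "has_mat_deriv N Y E t"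
    and n: "\<And>s p k. p < n \<Longrightarrow> dcoef N (Y s) p k = 0"
  shows "has_mat_deriv N (\<lambda>s. X s * Y s) (D * Y t + X t * E) t"
proof -
  have dX: "((\<lambda>s. dcoef N (X s) p k) has_real_derivative dcoef N D p k) (at t)" for p k
    using X has_mat_deriv_loop[of X D t] by blast
  have dY: "((\<lambda>s. dcoef N (Y s) p k) has_real_derivative dcoef N E p k) (at t)" for p k
    using Y has_mat_deriv_loop[of Y E t] by blast
  \<comment> \<open>A coefficient that vanishes identically in s has derivative zero, so D inherits
    the bound of X and the same convolution range applies to D Y.\<close>
  have mD: "dcoef N D p k = 0" if "p < m" for p k
    using dX[of p k] m[OF that] by (simp add: DERIV_unique[OF _ DERIV_const])
  have nE: "dcoef N E p k = 0" if "p < n" for p k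
    using dY[of p k] n[OF that] by (simp add: DERIV_unique[OF _ DERIV_const])
  have "((\<lambda>s. dcoef N (X s * Y s) p k) has_real_derivative dcoef N (D * Y t + X t * E) p k) (at t)" for p k
  proof -
    have "((\<lambda>s. \<Sum>q=m..p-n. dcoef N (X s) q k * dcoef N (Y s) (p - q) (k - q)) has_real_derivative
      (\<Sum>q=m..p-n. dcoef N D q k * dcoef N (Y t) (p - q) (k - q)
        + dcoef N E (p - q) (k - q) * dcoef N (X t) q k)) (at t)"
      by (intro DERIV_sum DERIV_mult dX dY)
    then show ?thesis
      using X Y m n mD nE
      by (simp add: dcoef_add loop_series_mult dcoef_mult_bounded[where m = m and n = n]
          sum.distrib mult.commute)
  qed
  then show ?thesis
    using X Y by (subst has_mat_deriv_loop) (auto simp: loop_series_mult loop_series_add)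
qed

text \<open>All degrees of U but one are constant in s; uniqueness of derivatives forces D to vanish
  there, and the moving degree gives the scalar equations.\<close>

lemma has_mat_deriv_Umat:
  assumes u: "\<And>s. periodic N (u s)" and D: "D \<in> loop_series N"
  shows "has_mat_deriv N (\<lambda>s. Umat N (u s)) D t \<longleftrightarrow>
    (\<forall>p k. p \<noteq> 0 \<longrightarrow> dcoef N D p k = 0) \<and> (\<forall>k. ((\<lambda>s. u s k) has_real_derivative dcoef N D 0 k) (at t))"
proof -
  have "((\<lambda>s. dcoef N (Umat N (u s)) p k) has_real_derivative dcoef N D p k) (at t)
      \<longleftrightarrow> (if p = 0 then ((\<lambda>s. u s k) has_real_derivative dcoef N D 0 k) (at t) else dcoef N D p k = 0)"
    for p k
    using DERIV_unique[of "\<lambda>s. dcoef N (Umat N (u s)) p k" "dcoef N D p k" t 0]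
    by (auto simp: dcoef_Umat[OF u])
  then show ?thesis
    by (subst has_mat_deriv_loop) (auto simp: loop_series_Umat D)
qed

lemma has_mat_deriv_Vmat:
  assumes v: "\<And>s. periodic N (v s)" and D: "D \<in> loop_series N"
  shows "has_mat_deriv N (\<lambda>s. Vmat N (v s)) D t \<longleftrightarrow>
    (\<forall>p k. p \<noteq> -1 \<longrightarrow> dcoef N D p k = 0) \<and> (\<forall>k. ((\<lambda>s. v s k) has_real_derivative dcoef N D (-1) k) (at t))"
proof -
  have "((\<lambda>s. dcoef N (Vmat N (v s)) p k) has_real_derivative dcoef N D p k) (at t)
      \<longleftrightarrow> (if p = -1 then ((\<lambda>s. v s k) has_real_derivative dcoef N D (-1) k) (at t) else dcoef N D p k = 0)"
    for p k
    using DERIV_unique[of "\<lambda>s. dcoef N (Vmat N (v s)) p k" "dcoef N D p k" t 0]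
    by (cases "p = 0"; cases "p = -1") (auto simp: dcoef_Vmat[OF v])
  then show ?thesis
    by (subst has_mat_deriv_loop) (auto simp: loop_series_Vmat D)
qed

lemma has_mat_deriv_Fmat:
  "has_mat_deriv N (\<lambda>s. Fmat N h) (0\<^sub>m N N) t"
  by (simp add: has_mat_deriv_def)

section \<open>The Lax equation for the product\<close>

lemma loop_series_zero: "0\<^sub>m N N \<in> loop_series N"
  by (rule loop_seriesI) auto

lemma loop_series_telescope:
  assumes "P \<in> loop_series N" "Q \<in> loop_series N" "R \<in> loop_series N" "S \<in> loop_series N"
  shows "(P - Q) + ((Q - R) + (R - S)) = P - S"
  using assms[THEN loop_series_carrier] by (intro eq_matI) auto

lemma loop_series_diff_distrib:
  assumes "P \<in> loop_series N" "Q \<in> loop_series N" "R \<in> loop_series N"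
  shows "(P - Q) * R = P * R - Q * R" "R * (P - Q) = R * P - R * Q"
  using assms[THEN loop_series_carrier]
  by (auto intro: minus_mult_distrib_mat mult_minus_distrib_mat)

lemma loop_series_add_distrib:
  assumes "P \<in> loop_series N" "Q \<in> loop_series N" "R \<in> loop_series N"
  shows "R * (P + Q) = R * P + R * Q"
  using assms[THEN loop_series_carrier] by (auto intro: mult_add_distrib_mat)

text \<open>The matrices in the triads are paired in the order of the factors U W V: what one triad
  subtracts on the right, the next adds on the left. In the product rule the terms with A3 and A2
  cancel, and only A1 in front and A0 at the end remain.\<close>

lemma lax_triad_Lplus:
  assumes per: "\<And>s. periodic N (u s)" "\<And>s. periodic N (v s)" "\<And>s. periodic N (w s)"
    and A: "A0 \<in> loop_series N" "A1 \<in> loop_series N" "A2 \<in> loop_series N" "A3 \<in> loop_series N"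
    and lax: "lax_triad N h A0 A1 A2 A3 u v w t"
    and F: "A1 * Fmat N h = Fmat N h * A0"
  shows "has_mat_deriv N (\<lambda>s. Lplus N h (u s) (v s) (w s))
    (A0 * Lplus N h (u t) (v t) (w t) - Lplus N h (u t) (v t) (w t) * A0) t"
proof -
  note ls = loop_series_mult loop_series_diff loop_series_add loop_series_Finv
      loop_series_Umat loop_series_Wmat loop_series_Vmat loop_series_Fmat A
  note as = loop_series_assoc
  let ?U = "Umat N (u t)" and ?V = "Vmat N (v t)" and ?W = "Wmat N (w t)" and ?G = "Finv N h"
  let ?D = "?G * ((A1 * ?U - ?U * A3) * (?W * ?V) + ?U * ((A3 * ?W - ?W * A2) * ?V + ?W * (A2 * ?V - ?V * A0)))"
  have WV: "has_mat_deriv N (\<lambda>s. Wmat N (w s) * Vmat N (v s))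
      ((A3 * ?W - ?W * A2) * ?V + ?W * (A2 * ?V - ?V * A0)) t"
    by (rule has_mat_deriv_mult[where m = "-1" and n = "-1"])
      (use lax per in \<open>auto simp: ls lax_triad_def Wmat_eq_Vmat dcoef_Vmat\<close>)
  have WVb: "dcoef N (Wmat N (w s) * Vmat N (v s)) p k = 0" if "p < -2" for s p k
    by (subst dcoef_mult_bounded[where m = "-1" and n = "-1"])
      (use that per in \<open>auto simp: ls Wmat_eq_Vmat dcoef_Vmat\<close>)
  have UWV: "has_mat_deriv N (\<lambda>s. Umat N (u s) * (Wmat N (w s) * Vmat N (v s)))
      ((A1 * ?U - ?U * A3) * (?W * ?V) + ?U * ((A3 * ?W - ?W * A2) * ?V + ?W * (A2 * ?V - ?V * A0))) t"
    by (rule has_mat_deriv_mult[where m = 0 and n = "-2"])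
      (use lax per WV WVb in \<open>auto simp: ls lax_triad_def dcoef_Umat\<close>)
  have UWVb: "dcoef N (Umat N (u s) * (Wmat N (w s) * Vmat N (v s))) p k = 0" if "p < -2" for s p k
    by (subst dcoef_mult_bounded[where m = 0 and n = "-2"])
      (use that per WVb in \<open>auto simp: ls dcoef_Umat\<close>)
  \<comment> \<open>F^-1 is constant, so it enters the product rule with derivative zero. Its powers
    start at 0, those of U W V at -2.\<close>
  have "has_mat_deriv N (\<lambda>s. ?G * (Umat N (u s) * (Wmat N (w s) * Vmat N (v s))))
      (0\<^sub>m N N * (?U * (?W * ?V)) + ?D) t"
    by (rule has_mat_deriv_mult[where m = 0 and n = "-2"])
      (use UWV UWVb in \<open>auto simp: ls loop_series_zero dcoef_Finv has_mat_deriv_def\<close>)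
  moreover have "?D \<in> loop_series N" by (simp add: ls)
  then have "0\<^sub>m N N * (?U * (?W * ?V)) + ?D = ?D"
    using left_mult_zero_mat[OF loop_series_carrier[of "?U * (?W * ?V)"], where nr = N]
      left_add_zero_mat[OF loop_series_carrier[of ?D]]
    by (simp add: ls)
  moreover have "Lplus N h (u s) (v s) (w s) = ?G * (Umat N (u s) * (Wmat N (w s) * Vmat N (v s)))" for s
    by (simp add: Lplus_def ls as)
  moreover have "?D = A0 * Lplus N h (u t) (v t) (w t) - Lplus N h (u t) (v t) (w t) * A0"
  proof -
    have FG: "Fmat N h * (?G * Z) = Z" if "Z \<in> loop_series N" for Z
      using that as[of "Fmat N h" ?G Z] by (simp add: ls Fmat_times_Finv[OF N] loop_series_one_mult)
    have GF: "?G * (Fmat N h * Z) = Z" if "Z \<in> loop_series N" for Z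
      using that as[of ?G "Fmat N h" Z] by (simp add: ls Finv_times_Fmat loop_series_one_mult)
    \<comment> \<open>A1 F = F A0 becomes F^-1 A1 = A0 F^-1, which carries the leading A1 to the
      front as A0.\<close>
    have "?G * A1 = ?G * (A1 * Fmat N h) * ?G"
      by (simp add: ls as Fmat_times_Finv[OF N] loop_series_mult_one)
    also have "\<dots> = A0 * ?G" by (simp only: F) (simp add: ls as GF)
    finally have GA: "?G * (A1 * Z) = A0 * (?G * Z)" if "Z \<in> loop_series N" for Z
      using that as[of ?G A1 Z] as[of A0 ?G Z] by (simp add: ls)
    have "(A1 * ?U - ?U * A3) * (?W * ?V) + ?U * ((A3 * ?W - ?W * A2) * ?V + ?W * (A2 * ?V - ?V * A0))
      = (A1 * (?U * (?W * ?V)) - ?U * (A3 * (?W * ?V)))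
        + ((?U * (A3 * (?W * ?V)) - ?U * (?W * (A2 * ?V))) + (?U * (?W * (A2 * ?V)) - ?U * (?W * (?V * A0))))"
      by (simp add: loop_series_diff_distrib loop_series_add_distrib ls as)
    also have "\<dots> = A1 * (?U * (?W * ?V)) - ?U * (?W * (?V * A0))"
      by (rule loop_series_telescope) (simp_all add: ls)
    finally show ?thesis
      by (simp add: loop_series_diff_distrib ls as GA Lplus_def)
  qed
  ultimately show ?thesis by simp
qed

text \<open>Compatibility is forced by the existence of a differentiable curve: the constant degrees
  of U, V, W confine the right-hand sides to the degree that moves.\<close>

lemma lax_triad_compatible:
  assumes f: "conj_covariant N f"
    and per: "\<And>s. periodic N (u s)" "\<And>s. periodic N (v s)" "\<And>s. periodic N (w s)"
    and lp: "A1 \<in> loop_poly N" "A2 \<in> loop_poly N" "A3 \<in> loop_poly N"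
    and lax: "lax_triad N h (A0mat N h f (u t) (v t) (w t)) A1 A2 A3 u v w t"
  shows "compatible N h f (u t) (v t) (w t) A1 A2 A3 \<and>
    has_mat_deriv N (\<lambda>s. Lplus N h (u s) (v s) (w s))
      (A0mat N h f (u t) (v t) (w t) * Lplus N h (u t) (v t) (w t)
        - Lplus N h (u t) (v t) (w t) * A0mat N h f (u t) (v t) (w t)) t"
proof -
  let ?A0 = "A0mat N h f (u t) (v t) (w t)"
  have A0: "?A0 \<in> loop_series N"
    unfolding A0mat_eq[OF f] by (intro loop_series_lax_part N loop_series_lax f)
  note A = lp[THEN loop_poly_series]
  note ls = loop_series_mult loop_series_diff
      loop_series_Umat loop_series_Wmat loop_series_Vmat loop_series_Fmat A A0
  have "A1 * Fmat N h - Fmat N h * ?A0 = 0\<^sub>m N N" using lax by (simp add: lax_triad_def)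
  then have "dcoef N (A1 * Fmat N h) p k - dcoef N (Fmat N h * ?A0) p k = 0" for p k
    using dcoef_diff[of "A1 * Fmat N h" "Fmat N h * ?A0" p k] by (simp add: ls dcoef_def ix_less)
  then have F: "A1 * Fmat N h = Fmat N h * ?A0"
    by (intro loop_series_eqI) (simp_all add: ls)
  have "compatible N h f (u t) (v t) (w t) A1 A2 A3"
    unfolding compatible_def ex_up_iff ex_diag_iff
    using lax per F lp
    by (simp add: lax_triad_def ls has_mat_deriv_Umat has_mat_deriv_Vmat Wmat_eq_Vmat)
  then show ?thesis using lax_triad_Lplus[OF per A0 A lax F] by blast
qed

subsection \<open>The first flow\<close>

lemma dcoef_band:
  assumes "periodic N a" "periodic N b" "periodic N c"
  shows "dcoef N (band N a b c) p k =
    (if p = 0 then - c k else if p = -1 then a k else if p = -2 then b k else 0)"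
  using assms unfolding band_def
  by (simp add: dcoef_diff dcoef_add loop_series_add loop_series_up
      loop_series_up2 loop_series_diag dcoef_up dcoef_up2 dcoef_diag)

lemma loop_series_band: "band N a b c \<in> loop_series N"
  unfolding band_def
  by (intro loop_series_diff loop_series_add loop_series_up loop_series_up2
      loop_series_diag)

lemma loop_poly_band:
  assumes "periodic N a" "periodic N b" "periodic N c"
  shows "band N a b c \<in> loop_poly N"
  by (rule loop_polyI[OF loop_series_band, of 0]) (simp add: dcoef_band assms)

lemma cont_field_three_terms:
  assumes "\<And>x. x \<in> phase N \<Longrightarrow> X x \<in> loop_series N"
    and "\<And>x p k. x \<in> phase N \<Longrightarrow> dcoef N (X x) p k =
      (if p = 0 then c x k else if p = -1 then a x k else if p = -2 then b x k else 0)"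
    and "\<And>k. continuous_on (phase N) (\<lambda>x. c x k)" "\<And>k. continuous_on (phase N) (\<lambda>x. a x k)"
      "\<And>k. continuous_on (phase N) (\<lambda>x. b x k)"
  shows "cont_field N X"
proof (rule cont_fieldI[where m = "-2"])
  fix p k :: int
  have "continuous_on (phase N)
      (\<lambda>x. if p = 0 then c x k else if p = -1 then a x k else if p = -2 then b x k else 0)"
    by (cases "p = 0"; cases "p = -1"; cases "p = -2") (auto intro: continuous_intros assms)
  then show "continuous_on (phase N) (\<lambda>x. dcoef N (X x) p k)"
    by (rule continuous_on_eq) (simp add: assms(2))
qed (simp_all add: assms(1,2))

lemmas first_band = first_A0_def[folded band_def] first_A1_def[folded band_def]
  first_A2_def[folded band_def] first_A3_def[folded band_def]

lemma loop_series_first: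
  "first_A0 N h u v w \<in> loop_series N" "first_A1 N h u v w \<in> loop_series N"
  "first_A2 N h u v w \<in> loop_series N" "first_A3 N h u v w \<in> loop_series N"
  unfolding first_band by (rule loop_series_band)+

lemma loop_poly_first:
  assumes "periodic N u" "periodic N v" "periodic N w"
  shows "first_A1 N h u v w \<in> loop_poly N"
    "first_A2 N h u v w \<in> loop_poly N" "first_A3 N h u v w \<in> loop_poly N"
  unfolding first_band
  by (rule loop_poly_band; rule periodicI; simp add: gam_def periodic_simps assms)+

lemma dcoef_first:
  assumes "periodic N u" "periodic N v" "periodic N w"
  shows "dcoef N (first_A0 N h u v w) p k = (if p = 0 then - (h * gam h u v w k)
      else if p = -1 then w (k - 1) * v k + u k * v k + u k * w k + h * u (k - 1) * w (k - 1) * v k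
      else if p = -2 then u k * w k * v (k + 1) else 0)"
    "dcoef N (first_A1 N h u v w) p k = (if p = 0 then - (h * gam h u v w (k - 1))
      else if p = -1 then w (k - 1) * v k + u k * v k + u k * w k + h * u k * w k * v (k + 1)
      else if p = -2 then u k * w k * v (k + 1) else 0)"
    "dcoef N (first_A2 N h u v w) p k = (if p = 0 then - (h * gam h u v w k)
      else if p = -1 then u k * w k + v k * w k + v k * u (k + 1) + h * u k * v k * w k
      else if p = -2 then v k * u (k + 1) * w (k + 1) else 0)"
    "dcoef N (first_A3 N h u v w) p k = (if p = 0 then - (h * gam h u v w k)
      else if p = -1 then v k * u (k + 1) + w k * u (k + 1) + w k * v (k + 1)
        + h * w k * u (k + 1) * v (k + 1)
      else if p = -2 then w k * v (k + 1) * u (k + 2) else 0)"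
  unfolding first_band
  by (subst dcoef_band; (rule refl | rule periodicI, simp add: gam_def periodic_simps assms))+

lemma conj_covariant_id: "conj_covariant N (\<lambda>L. L)"
  by (simp add: conj_covariant_def)

text \<open>Only the negative degrees of L_+ enter A0, and these are the degrees -1 and -2.\<close>

lemma dcoef_Lplus:
  assumes per: "periodic N u" "periodic N v" "periodic N w"
  shows "p < -2 \<Longrightarrow> dcoef N (Lplus N h u v w) p k = 0"
    "dcoef N (Lplus N h u v w) (-2) k = u k * w k * v (k + 1)"
    "dcoef N (Lplus N h u v w) (-1) k
      = w (k - 1) * v k + u k * v k + u k * w k + h * u (k - 1) * w (k - 1) * v k"
proof -
  note ls = loop_series_mult loop_series_Finv
      loop_series_Umat loop_series_Wmat loop_series_Vmat
  let ?K = "Umat N u * Wmat N w * Vmat N v"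
  have K: "dcoef N ?K p k = dcoef N (Umat N u) p k + dcoef N (Umat N u) (p + 1) k * w (k - p - 1)
      + (dcoef N (Umat N u) (p + 1) k + dcoef N (Umat N u) (p + 2) k * w (k - p - 2)) * v (k - p - 1)"
    for p k
    by (simp add: Wmat_eq_Vmat dcoef_mult_Vmat ls per algebra_simps)
  have L: "Lplus N h u v w = Finv N h * ?K"
    by (simp add: Lplus_def ls loop_series_assoc)
  \<comment> \<open>U W V starts in degree -2 and F^-1 in degree 0, so the sum is finite; it has one
    term in degree -2 and two in degree -1.\<close>
  have dL: "dcoef N (Lplus N h u v w) p k = (\<Sum>q=0..p + 2. h ^ nat q * dcoef N ?K (p - q) (k - q))" for p k
  proof -
    have "dcoef N (Lplus N h u v w) p k
        = (\<Sum>q=0..p - (-2). dcoef N (Finv N h) q k * dcoef N ?K (p - q) (k - q))"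
      unfolding L
      by (rule dcoef_mult_bounded) (simp_all add: ls K dcoef_Finv dcoef_Umat per)
    then show ?thesis by (simp add: dcoef_Finv)
  qed
  show "p < -2 \<Longrightarrow> dcoef N (Lplus N h u v w) p k = 0" by (simp add: dL)
  show "dcoef N (Lplus N h u v w) (-2) k = u k * w k * v (k + 1)"
    by (simp add: dL K dcoef_Umat per add.commute)
  have "{0..1::int} = {0, 1}" by auto
  then show "dcoef N (Lplus N h u v w) (-1) k
      = w (k - 1) * v k + u k * v k + u k * w k + h * u (k - 1) * w (k - 1) * v k"
    by (simp add: dL K dcoef_Umat per algebra_simps)
qed

text \<open>This is the origin of \<gamma>: h times the coefficient of L_+ in degree -1 plus h^2
  times the one in degree -2 equals h \<gamma>_k.\<close>

lemma A0mat_first: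
  assumes per: "periodic N u" "periodic N v" "periodic N w"
  shows "A0mat N h (\<lambda>L. L) u v w = first_A0 N h u v w"
proof -
  have s: "sigma_coef h (Lplus N h u v w) k = h * gam h u v w k" for k
  proof -
    have "{1..2::nat} = {1, 2}" by auto
    then show ?thesis
      by (subst sigma_coef_bounded[of 2])
        (simp_all add: dcoef_Lplus per gam_def power2_eq_square algebra_simps)
  qed
  have "dcoef N (A0mat N h (\<lambda>L. L) u v w) p k = dcoef N (first_A0 N h u v w) p k" for p k
  proof -
    have per': "periodic N (\<lambda>k. - (h * gam h u v w k))"
      by (rule periodicI) (simp add: gam_def periodic_simps per)
    consider "p < -2" | "p = -2" | "p = -1" | "p = 0" | "p > 0" by linarith
    then show ?thesis
      by cases (simp_all add: A0mat_eq[OF conj_covariant_id] lax0_def s dcoef_lax_part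
          loop_series_Lplus per' dcoef_first per dcoef_Lplus)
  qed
  then show ?thesis
    by (intro loop_series_eqI)
      (simp_all add: A0mat_eq[OF conj_covariant_id] loop_series_lax_part
        loop_series_lax[OF conj_covariant_id] loop_series_first)
qed

text \<open>Direct expansion by the two-term product formulas. The coefficients in the single free
  degree are the right-hand sides of the equations of motion.\<close>

lemma first_degrees:
  assumes per: "periodic N u" "periodic N v" "periodic N w"
  shows "first_A1 N h u v w * Fmat N h = Fmat N h * first_A0 N h u v w"
    and "dcoef N (first_A1 N h u v w * Umat N u - Umat N u * first_A3 N h u v w) p k =
      (if p = 0 then u k * (v k + w k - v (k - 1) - w (k - 1) + h * w k * v (k + 1) - h * w (k - 1) * v k
        + h * gam h u v w k - h * gam h u v w (k - 1)) else 0)"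
    and "dcoef N (first_A2 N h u v w * Vmat N v - Vmat N v * first_A0 N h u v w) p k =
      (if p = -1 then v k * (w k + u (k + 1) - w (k - 1) - u k + h * u k * w k - h * u (k - 1) * w (k - 1)
        + h * gam h u v w (k + 1) - h * gam h u v w k) else 0)"
    and "dcoef N (first_A3 N h u v w * Wmat N w - Wmat N w * first_A2 N h u v w) p k =
      (if p = -1 then w k * (u (k + 1) + v (k + 1) - u k - v k + h * u (k + 1) * v (k + 1) - h * u k * v k
        + h * gam h u v w (k + 1) - h * gam h u v w k) else 0)"
proof -
  note ls = loop_series_mult loop_series_first loop_series_Fmat
      loop_series_Umat loop_series_Wmat loop_series_Vmat
  \<comment> \<open>The matrices occupy degrees -2..0 and the factors degrees -1..1, so outside
    -3..1 every product vanishes.\<close>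
  have cases: thesis if "p \<notin> {-3, -2, -1, 0, 1} \<Longrightarrow> thesis" "p = -3 \<Longrightarrow> thesis" "p = -2 \<Longrightarrow> thesis"
    "p = -1 \<Longrightarrow> thesis" "p = 0 \<Longrightarrow> thesis" "p = 1 \<Longrightarrow> thesis" for p :: int and thesis
    using that by (cases "p \<in> {-3, -2, -1, 0, 1}") auto
  have "dcoef N (first_A1 N h u v w * Fmat N h) p k = dcoef N (Fmat N h * first_A0 N h u v w) p k" for p k
    by (rule cases[of p]) (simp_all add: ls dcoef_mult_Fmat dcoef_Fmat_mult dcoef_first per
        gam_def algebra_simps)
  then show "first_A1 N h u v w * Fmat N h = Fmat N h * first_A0 N h u v w"
    by (intro loop_series_eqI) (simp_all add: ls)
  show "dcoef N (first_A1 N h u v w * Umat N u - Umat N u * first_A3 N h u v w) p k =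
      (if p = 0 then u k * (v k + w k - v (k - 1) - w (k - 1) + h * w k * v (k + 1) - h * w (k - 1) * v k
        + h * gam h u v w k - h * gam h u v w (k - 1)) else 0)"
    by (rule cases[of p]) (simp_all add: ls dcoef_diff dcoef_mult_Umat dcoef_Umat_mult
        dcoef_first per algebra_simps)
  show "dcoef N (first_A2 N h u v w * Vmat N v - Vmat N v * first_A0 N h u v w) p k =
      (if p = -1 then v k * (w k + u (k + 1) - w (k - 1) - u k + h * u k * w k - h * u (k - 1) * w (k - 1)
        + h * gam h u v w (k + 1) - h * gam h u v w k) else 0)"
    by (rule cases[of p]) (simp_all add: ls dcoef_diff dcoef_mult_Vmat dcoef_Vmat_mult
        dcoef_first per algebra_simps)
  show "dcoef N (first_A3 N h u v w * Wmat N w - Wmat N w * first_A2 N h u v w) p k =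
      (if p = -1 then w k * (u (k + 1) + v (k + 1) - u k - v k + h * u (k + 1) * v (k + 1) - h * u k * v k
        + h * gam h u v w (k + 1) - h * gam h u v w k) else 0)"
    by (rule cases[of p]) (simp_all add: ls dcoef_diff dcoef_mult_Vmat dcoef_Vmat_mult
        Wmat_eq_Vmat dcoef_first per algebra_simps)
qed

lemma compatible_first:
  assumes per: "periodic N u" "periodic N v" "periodic N w"
  shows "compatible N h (\<lambda>L. L) u v w (first_A1 N h u v w) (first_A2 N h u v w) (first_A3 N h u v w)"
  unfolding compatible_def ex_diag_iff ex_up_iff A0mat_first[OF per]
  by (simp add: first_degrees per loop_poly_first loop_series_mult loop_series_diff
      loop_series_first loop_series_Umat loop_series_Wmat loop_series_Vmat)

text \<open>Together with uniqueness of compatible fields this identifies the displayed matrices as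
  those determined by compatibility, at degenerate phase points too.\<close>

lemma compatible_fields_first:
  "compatible_fields N h (\<lambda>L. L) (\<lambda>(u, v, w). first_A1 N h u v w)
    (\<lambda>(u, v, w). first_A2 N h u v w) (\<lambda>(u, v, w). first_A3 N h u v w)"
  unfolding compatible_fields_def
proof (intro conjI)
  show "cont_field N (\<lambda>(u, v, w). first_A1 N h u v w)" "cont_field N (\<lambda>(u, v, w). first_A2 N h u v w)"
    "cont_field N (\<lambda>(u, v, w). first_A3 N h u v w)"
    unfolding case_prod_beta
    by (rule cont_field_three_terms, rule loop_series_first, rule dcoef_first,
        (erule phase_periodic)+, (unfold gam_def, (intro continuous_intros)+))+
  show "\<forall>(u, v, w)\<in>phase N. compatible N h (\<lambda>L. L) u v w
      (case (u, v, w) of (u, v, w) \<Rightarrow> first_A1 N h u v w)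
      (case (u, v, w) of (u, v, w) \<Rightarrow> first_A2 N h u v w)
      (case (u, v, w) of (u, v, w) \<Rightarrow> first_A3 N h u v w)"
    by (auto simp: phase_def intro: compatible_first)
qed

text \<open>Outside the free degrees the right-hand sides vanish identically, so the matrix
  equations amount to their coefficients in degree 0 for U and -1 for V and W.\<close>

lemma lax_triad_first:
  assumes per: "\<And>s. periodic N (u s)" "\<And>s. periodic N (v s)" "\<And>s. periodic N (w s)"
  shows "lax_triad N h (first_A0 N h (u t) (v t) (w t)) (first_A1 N h (u t) (v t) (w t))
      (first_A2 N h (u t) (v t) (w t)) (first_A3 N h (u t) (v t) (w t)) u v w t
    \<longleftrightarrow>
    (\<forall>k.
       ((\<lambda>s. u s k) has_real_derivative
          u t k * (v t k + w t k - v t (k - 1) - w t (k - 1)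
                   + h * w t k * v t (k + 1) - h * w t (k - 1) * v t k
                   + h * gam h (u t) (v t) (w t) k - h * gam h (u t) (v t) (w t) (k - 1))) (at t) \<and>
       ((\<lambda>s. v s k) has_real_derivative
          v t k * (w t k + u t (k + 1) - w t (k - 1) - u t k
                   + h * u t k * w t k - h * u t (k - 1) * w t (k - 1)
                   + h * gam h (u t) (v t) (w t) (k + 1) - h * gam h (u t) (v t) (w t) k)) (at t) \<and>
       ((\<lambda>s. w s k) has_real_derivative
          w t k * (u t (k + 1) + v t (k + 1) - u t k - v t k
                   + h * u t (k + 1) * v t (k + 1) - h * u t k * v t k
                   + h * gam h (u t) (v t) (w t) (k + 1) - h * gam h (u t) (v t) (w t) k)) (at t))"
proof -
  note ls = loop_series_mult loop_series_diff loop_series_first loop_series_Fmat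
      loop_series_Umat loop_series_Wmat loop_series_Vmat
  let ?A0 = "first_A0 N h (u t) (v t) (w t)" and ?A1 = "first_A1 N h (u t) (v t) (w t)"
    and ?A2 = "first_A2 N h (u t) (v t) (w t)" and ?A3 = "first_A3 N h (u t) (v t) (w t)"
  have c: "Fmat N h * ?A0 \<in> carrier_mat N N"
    by (rule loop_series_carrier) (simp add: ls)
  have F: "?A1 * Fmat N h - Fmat N h * ?A0 = 0\<^sub>m N N"
    unfolding first_degrees(1)[OF per] using c by (rule minus_r_inv_mat)
  have U: "?A1 * Umat N (u t) - Umat N (u t) * ?A3 \<in> loop_series N"
    and V: "?A2 * Vmat N (v t) - Vmat N (v t) * ?A0 \<in> loop_series N"
    and W: "?A3 * Wmat N (w t) - Wmat N (w t) * ?A2 \<in> loop_series N"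
    by (simp_all add: ls)
  show ?thesis
    unfolding lax_triad_def F has_mat_deriv_Umat[OF per(1) U] has_mat_deriv_Vmat[OF per(2) V]
      has_mat_deriv_Vmat[OF per(3), folded Wmat_eq_Vmat, OF W]
    by (simp add: first_degrees[OF per] has_mat_deriv_Fmat all_conj_distrib)
qed

end

theorem theorem5p4:
  fixes N :: nat and h :: real
  assumes "1 \<le> N"
  shows
    "(\<forall>f. conj_covariant N f \<longrightarrow>
        (\<forall>(u, v, w)\<in>phase N.
           (\<exists>A1 A2 A3. compatible N h f u v w A1 A2 A3) \<and>
           (nondegenerate u v w \<longrightarrow>
              (\<forall>A1 A2 A3 B1 B2 B3.
                 compatible N h f u v w A1 A2 A3 \<and> compatible N h f u v w B1 B2 B3
                 \<longrightarrow> A1 = B1 \<and> A2 = B2 \<and> A3 = B3))) \<and>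
        (\<forall>A1 A2 A3 B1 B2 B3.
           compatible_fields N h f A1 A2 A3 \<and> compatible_fields N h f B1 B2 B3
           \<longrightarrow> (\<forall>x\<in>phase N. A1 x = B1 x \<and> A2 x = B2 x \<and> A3 x = B3 x)) \<and>
        (cont_preserving N f \<longrightarrow> (\<exists>A1 A2 A3. compatible_fields N h f A1 A2 A3)) \<and>
        (\<forall>u v w t A1 A2 A3.
           (\<forall>s. (u s, v s, w s) \<in> phase N) \<and>
           A1 \<in> loop_poly N \<and> A2 \<in> loop_poly N \<and> A3 \<in> loop_poly N \<and>
           lax_triad N h (A0mat N h f (u t) (v t) (w t)) A1 A2 A3 u v w t
           \<longrightarrow> compatible N h f (u t) (v t) (w t) A1 A2 A3 \<and>
               has_mat_deriv N (\<lambda>s. Lplus N h (u s) (v s) (w s))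
                 (A0mat N h f (u t) (v t) (w t) * Lplus N h (u t) (v t) (w t)
                  - Lplus N h (u t) (v t) (w t) * A0mat N h f (u t) (v t) (w t)) t)) \<and>
     (conj_covariant N (\<lambda>L. L) \<and>
      (\<forall>(u, v, w)\<in>phase N.
         A0mat N h (\<lambda>L. L) u v w = first_A0 N h u v w \<and>
         compatible N h (\<lambda>L. L) u v w (first_A1 N h u v w) (first_A2 N h u v w) (first_A3 N h u v w)) \<and>
      compatible_fields N h (\<lambda>L. L) (\<lambda>(u, v, w). first_A1 N h u v w)
        (\<lambda>(u, v, w). first_A2 N h u v w) (\<lambda>(u, v, w). first_A3 N h u v w) \<and>
      (\<forall>u v w t. (\<forall>s. (u s, v s, w s) \<in> phase N) \<longrightarrow>
         (lax_triad N h (first_A0 N h (u t) (v t) (w t)) (first_A1 N h (u t) (v t) (w t))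
            (first_A2 N h (u t) (v t) (w t)) (first_A3 N h (u t) (v t) (w t)) u v w t
          \<longleftrightarrow>
          (\<forall>k.
             ((\<lambda>s. u s k) has_real_derivative
                u t k * (v t k + w t k - v t (k - 1) - w t (k - 1)
                         + h * w t k * v t (k + 1) - h * w t (k - 1) * v t k
                         + h * gam h (u t) (v t) (w t) k - h * gam h (u t) (v t) (w t) (k - 1))) (at t) \<and>
             ((\<lambda>s. v s k) has_real_derivative
                v t k * (w t k + u t (k + 1) - w t (k - 1) - u t k
                         + h * u t k * w t k - h * u t (k - 1) * w t (k - 1)
                         + h * gam h (u t) (v t) (w t) (k + 1) - h * gam h (u t) (v t) (w t) k)) (at t) \<and>
             ((\<lambda>s. w s k) has_real_derivative
                w t k * (u t (k + 1) + v t (k + 1) - u t k - v t k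
                         + h * u t (k + 1) * v t (k + 1) - h * u t k * v t k
                         + h * gam h (u t) (v t) (w t) (k + 1) - h * gam h (u t) (v t) (w t) k)) (at t)))))"
proof -
  have N: "0 < N" using assms by simp
  have phase: "periodic N u" "periodic N v" "periodic N w" if "(u, v, w) \<in> phase N" for u v w
    using that by (auto simp: phase_def)
  show ?thesis
  proof (intro conjI allI impI, goal_cases)
    case (1 f)
    show ?case
    proof (clarify, intro conjI allI impI)
      fix u v w assume uvw: "(u, v, w) \<in> phase N"
      show "\<exists>A1 A2 A3. compatible N h f u v w A1 A2 A3"
        using compatible_lax_part[OF N 1 phase[OF uvw]] by blast
      fix A1 A2 A3 B1 B2 B3
      assume "nondegenerate u v w"
        "compatible N h f u v w A1 A2 A3 \<and> compatible N h f u v w B1 B2 B3"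
      then have "A1 = B1 \<and> A2 = B2 \<and> A3 = B3"
        using compatible_unique[OF N 1 phase[OF uvw]] by blast
      then show "A1 = B1" "A2 = B2" "A3 = B3" by blast+
    qed
  next
    case (2 f A1 A2 A3 B1 B2 B3)
    then show ?case using compatible_fields_unique[OF N] by blast
  next
    case (3 f)
    then show ?case by (rule ex_compatible_fields[OF N])
  next
    \<comment> \<open>This case and the next are the two halves of one conclusion: compatibility at
      time t and the Lax equation for L_+.\<close>
    case (4 f u v w t A1 A2 A3)
    then have "\<And>s. periodic N (u s)" "\<And>s. periodic N (v s)" "\<And>s. periodic N (w s)"
      by (auto simp: phase_def)
    with 4 lax_triad_compatible[OF N 4(1), where u = u and v = v and w = w and t = t and h = h]
    show ?case by simp
  next
    case (5 f u v w t A1 A2 A3)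
    then have "\<And>s. periodic N (u s)" "\<And>s. periodic N (v s)" "\<And>s. periodic N (w s)"
      by (auto simp: phase_def)
    with 5 lax_triad_compatible[OF N 5(1), where u = u and v = v and w = w and t = t and h = h]
    show ?case by blast
  next
    case 6
    show ?case by (rule conj_covariant_id[OF N])
  next
    case 7
    show ?case using A0mat_first[OF N phase] compatible_first[OF N phase] by blast
  next
    case 8
    show ?case by (rule compatible_fields_first[OF N])
  next
    case (9 u v w t)
    then have "\<And>s. periodic N (u s)" "\<And>s. periodic N (v s)" "\<And>s. periodic N (w s)"
      by (auto simp: phase_def)
    then show ?case by (rule lax_triad_first[OF N])
  qed
qed

end
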